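(* Write $e_n=E_n/n!$. For a sequence $(c_0,c_1,\dots)$ let $H_n=\det(c_{i+j})_{0\le i,j\le n-1}$ ($n\ge1$), $H_0=1$. Then for integers $n\ge0$ (empty products equal $1$): (H12) $(e_1,0,e_3,0,e_5,0,\dots)$: $H_0=1$, $H_n=2^{(n-1)^2}\frac{(n-1)!}{(2n-1)!}\prod_{k=1}^{n-1}\frac{(k-1)!^2}{(2k-1)!^2}$ ($n\ge1$). (H13) $(e_1,e_3,e_5,\dots)$: $H_0=1$, $H_n=2^{(n-1)(2n-1)}\prod_{k=1}^{2n-2}\frac{k!}{(2k+1)!}$ ($n\ge1$). (H14) $(0,e_3,0,e_5,\dots)$: $H_{2n+1}=0$, $H_{2n}=(-1)^n2^{2n(2n-1)}\prod_{k=1}^{2n-1}\frac{k!^2}{(2k+1)!^2}$. (H15) $(0,e_1,0,e_3,0,e_5,\dots)$: $H_{2n+1}=0$, $H_0=1$, $H_{2n}=(-1)^n2^{2(n-1)(2n-1)}\prod_{k=1}^{2n-2}\frac{k!^2}{(2k+1)!^2}$ ($n\ge1$). (H16) $(e_1,e_2,e_3,\dots)$: $H_0=1$, $H_n=\frac{(n-1)!}{2^{n-1}(2n-1)!}\prod_{k=1}^{n-2}\frac{k!^2}{(2k+1)!^2}$ ($n\ge1$). (H17) $(e_0,e_1,e_2,\dots)$: $H_0=1$, $H_n=(-1)^{n(n-1)/2}\frac{1}{2^{n-1}}\prod_{k=2}^{n-1}\frac{(k-1)!^2}{(2k-1)!^2}$ ($n\ge1$). (H18) $(e_2,e_3,e_4,\dots)$: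 $H_n=(-1)^{n(n-1)/2}\frac{1}{2^n}\prod_{k=2}^{n}\frac{(k-1)!^2}{(2k-1)!^2}$. (H19) $(e_3,e_4,e_5,\dots)$: $H_n=\frac{(n+1)(n+1)!}{2^n(2n+1)!}\prod_{k=1}^{n-1}\frac{k!^2}{(2k+1)!^2}$. (H20) $(e_4,e_5,e_6,\dots)$: $H_n=(-1)^{n(n-1)/2}\frac{(n+1)(n+2)(n^2+3n+1)}{2^{n+1}}\prod_{k=1}^{n}\frac{k!^2}{(2k+1)!^2}$. (H21) $(e_3,0,e_5,0,\dots)$: $H_{2n}=2^{4n^2-1}\frac{(2n+2)!}{(4n+1)!}\prod_{k=1}^{2n-1}\frac{k!^2}{(2k+1)!^2}$ and $H_{2n+1}=2^{4n(n+1)}\frac{(2n+1)(2n+2)!}{(4n+3)!}\prod_{k=1}^{2n}\frac{k!^2}{(2k+1)!^2}$. (H22) $(e_3,e_5,e_7,\dots)$: $H_n=2^{n(2n-1)}\prod_{k=1}^{2n-1}\frac{k!}{(2k+1)!}$. (H23) $(e_5,e_7,\dots)$: $H_n=2^{n(2n+1)}(n+1)(2n+1)\prod_{k=1}^{2n}\frac{k!}{(2k+1)!}$. (H24) $(e_7,e_9,\dots)$: $H_n=2^{n(2n+3)}(2n+1)(4n^2+10n+3)\frac{(n+1)(n+2)(2n+3)}{3}\prod_{k=1}^{2n+1}\frac{k!}{(2k+1)!}$.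
   Context: The Euler numbers $E_n$ are defined by $\tan(x)+\sec(x)=\sum_{n\ge0}E_nx^n/n!$, and $e_n=E_n/n!$. *)

theory Defs
  imports
    Complex_Main
    "HOL-Computational_Algebra.Formal_Power_Series"
    "Jordan_Normal_Form.Determinant"
begin

definition euler_number :: "nat \<Rightarrow> real" where
  "euler_number n = fact n * fps_nth (fps_tan 1 + inverse (fps_cos 1)) n"

definition euler_coeff :: "nat \<Rightarrow> real" where
  "euler_coeff n = euler_number n / fact n"

definition hankel_det :: "(nat \<Rightarrow> real) \<Rightarrow> nat \<Rightarrow> real" where
  "hankel_det c n = det (mat n n (\<lambda>(i, j). c (i + j)))"

(* The convention that the empty Hankel determinant is 1 is already the library's. *)
lemma hankel_det_0: "hankel_det c 0 = 1"
  by (simp add: hankel_det_def)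

end

theory Submission
  imports Defs
begin

text \<open>All thirteen families reduce to two continued fractions: that of
  \<open>tan (sqrt x) / sqrt x\<close>, from the three-term recurrence of Bessel-type series, and that of
  \<open>tan x + sec x = (cos (x/2) + sin (x/2)) / (cos (x/2) - sin (x/2))\<close>, whose terms are
  combinations of the same series. A continued fraction of Jacobi type yields Pade denominators
  whose coefficients reduce the Hankel matrix to triangular form, so that the Hankel determinants
  are products of the partial numerators. Dropping the first term of a series turns one Stieltjes
  fraction into another by the quotient-difference rules, which gives the shifted families;
  substituting \<open>x\<^sup>2\<close> for \<open>x\<close> gives those with interleaved zeros at odd
  places; zeros at even places give antidiagonal blocks of size 2.\<close>

section \<open>Hankel determinants by row reduction\<close>

text \<open>Reversed Pade denominators are the monic orthogonal polynomials for the moments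
  \<open>c\<close>, and \<open>h n\<close> is their squared norm, so a Hankel determinant is a
  product of norms. When the moments begin 0, nonzero, there is no monic orthogonal polynomial of
  degree 1; this is why zeros at even places need blocks. The coefficients of the shifted fractions
  are guessed from the claimed formulas. If \<open>g n\<close> and \<open>g' n\<close> are the
  ratios of consecutive determinants for a series and for its shift, then
  \<open>q n = g' n / g n\<close> and \<open>e n = g (n + 1) / g' n\<close>. With this choice the
  product rules hold automatically, both sides being \<open>g' (n + 1) / g' n\<close>; the sum rules
  are the identities with real content. A Stieltjes fraction has two contractions to Jacobi form,
  one for the series and one for its shift. Hence each fraction yields two families of determinants,
  and the last shift of either series is reached without a Stieltjes fraction of its own.\<close>

definition orth_coeffs :: "(nat \<Rightarrow> real) \<Rightarrow> (nat \<Rightarrow> nat \<Rightarrow> real) \<Rightarrow> (nat \<Rightarrow> real) \<Rightarrow> bool" where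
  "orth_coeffs c p h \<longleftrightarrow>
     (\<forall>n. p n n = 1 \<and> (\<forall>i<n. (\<Sum>j\<le>n. p n j * c (i + j)) = 0) \<and>
          (\<Sum>j\<le>n. p n j * c (n + j)) = h n)"

text \<open>Stated for an arbitrary matrix, since it serves both the reduction to triangular form
  and the one to block triangular form.\<close>

lemma det_unitriangular_row_ops:
  fixes M p :: "nat \<Rightarrow> nat \<Rightarrow> real"
  assumes "\<And>i. p i i = 1"
  shows "det (mat N N (\<lambda>(i, j). M i j)) = det (mat N N (\<lambda>(i, j). \<Sum>k\<le>i. p i k * M k j))"
proof -
  define L where "L = mat N N (\<lambda>(i, j). if j \<le> i then p i j else 0)"
  define A where "A = mat N N (\<lambda>(i, j). M i j)"
  have carr: "L \<in> carrier_mat N N" "A \<in> carrier_mat N N"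
    by (simp_all add: L_def A_def)
  have "det L = prod_list (diag_mat L)"
    by (rule det_lower_triangular[OF _ carr(1)]) (simp add: L_def)
  also have "\<dots> = 1"
    by (simp add: prod_list_diag_prod L_def assms)
  finally have "det L = 1" .
  moreover have "L * A = mat N N (\<lambda>(i, j). \<Sum>k\<le>i. p i k * M k j)"
  proof (rule eq_matI)
    fix i j assume ij: "i < dim_row (mat N N (\<lambda>(i, j). \<Sum>k\<le>i. p i k * M k j))"
      "j < dim_col (mat N N (\<lambda>(i, j). \<Sum>k\<le>i. p i k * M k j))"
    have "(\<Sum>k = 0..<N. (if k \<le> i then p i k else 0) * M k j) = (\<Sum>k\<le>i. p i k * M k j)"
      using ij by (intro sum.mono_neutral_cong_right) auto
    with ij show "(L * A) $$ (i, j) = mat N N (\<lambda>(i, j). \<Sum>k\<le>i. p i k * M k j) $$ (i, j)"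
      by (simp add: L_def A_def scalar_prod_def)
  qed (simp_all add: L_def A_def)
  ultimately show ?thesis
    using det_mult[OF carr] by (simp add: A_def)
qed

lemma hankel_det_orth:
  assumes "orth_coeffs c p h"
  shows "hankel_det c N = (\<Prod>n<N. h n)"
proof -
  define U where "U = mat N N (\<lambda>(i, j). \<Sum>k\<le>i. p i k * c (k + j))"
  have "upper_triangular U"
    using assms by (auto simp: U_def orth_coeffs_def add.commute)
  then have "det U = prod_list (diag_mat U)"
    by (rule det_upper_triangular[of _ N]) (simp add: U_def)
  also have "\<dots> = (\<Prod>n<N. h n)"
    unfolding prod_list_diag_prod
    using assms by (auto simp: U_def orth_coeffs_def add.commute lessThan_atLeast0 intro!: prod.cong)
  finally show ?thesis
    using det_unitriangular_row_ops[of p N "\<lambda>i j. c (i + j)"] assms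
    by (simp add: hankel_det_def U_def orth_coeffs_def)
qed

section \<open>Zeros at even places\<close>

text \<open>The matrix is block upper triangular with diagonal blocks ((0, h), (h, 0)) of
  determinant \<open>- h^2\<close>; an odd size leaves a last block of size 1 with entry 0.\<close>

lemma det_block_upper_antidiagonal:
  fixes M :: "nat \<Rightarrow> nat \<Rightarrow> real"
  assumes lower: "\<And>a i j. j < 2 * a \<Longrightarrow> 2 * a \<le> i \<Longrightarrow> M i j = 0"
    and diag: "\<And>i. M i i = 0"
    and anti: "\<And>a. M (2 * a) (2 * a + 1) = h a" "\<And>a. M (2 * a + 1) (2 * a) = h a"
  shows "det (mat (2 * n) (2 * n) (\<lambda>(i, j). M i j)) = (-1) ^ n * (\<Prod>a<n. h a)\<^sup>2"
    and "det (mat (2 * n + 1) (2 * n + 1) (\<lambda>(i, j). M i j)) = 0"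
proof -
  have split: "det (mat (2 * n + k) (2 * n + k) (\<lambda>(i, j). M i j)) =
      det (mat (2 * n) (2 * n) (\<lambda>(i, j). M i j)) *
      det (mat k k (\<lambda>(i, j). M (2 * n + i) (2 * n + j)))" for n k
  proof -
    have eq: "mat (2 * n + k) (2 * n + k) (\<lambda>(i, j). M i j) =
      four_block_mat (mat (2 * n) (2 * n) (\<lambda>(i, j). M i j))
        (mat (2 * n) k (\<lambda>(i, j). M i (2 * n + j))) (0\<^sub>m k (2 * n))
        (mat k k (\<lambda>(i, j). M (2 * n + i) (2 * n + j)))"
      using lower by (intro eq_matI) auto
    show ?thesis
      unfolding eq by (rule det_four_block_mat_lower_left_zero) auto
  qed
  show "det (mat (2 * n) (2 * n) (\<lambda>(i, j). M i j)) = (-1) ^ n * (\<Prod>a<n. h a)\<^sup>2"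
  proof (induction n)
    case 0
    show ?case by simp
  next
    case (Suc n)
    have "det (mat 2 2 (\<lambda>(i, j). M (2 * n + i) (2 * n + j))) = - (h n)\<^sup>2"
      using diag[of "2 * n"] diag[of "2 * n + 1"] anti[of n]
      using laplace_expansion_row[of "mat 2 2 (\<lambda>(i, j). M (2 * n + i) (2 * n + j))" 2 0]
      by (simp add: cofactor_def mat_delete_def det_single power2_eq_square numeral_2_eq_2)
    then show ?case
      using split[of n 2] Suc by (simp add: power_mult_distrib)
  qed
  show "det (mat (2 * n + 1) (2 * n + 1) (\<lambda>(i, j). M i j)) = 0"
    using split[of n 1] diag by (simp add: det_single)
qed

text \<open>The row operations use the polynomials \<open>x^r P_a(x^2)\<close> with
  \<open>r < 2\<close>, where \<open>P_a\<close> is orthogonal for \<open>c\<close>. Their moments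
  against \<open>x^j\<close> vanish when \<open>r + j\<close> is even and otherwise are moments of
  \<open>P_a\<close> for \<open>c\<close>.\<close>

lemma hankel_det_odd_interleaved:
  assumes "orth_coeffs c p h"
  shows "hankel_det (\<lambda>k. if odd k then c (k div 2) else 0) (2 * n) = (-1) ^ n * (\<Prod>a<n. h a)\<^sup>2"
    and "hankel_det (\<lambda>k. if odd k then c (k div 2) else 0) (2 * n + 1) = 0"
proof -
  define g where "g = (\<lambda>k. if odd k then c (k div 2) else 0)"
  \<comment> \<open>Row \<open>2 * a + r\<close> is combined only with rows \<open>2 * l + r\<close>
    of the same parity, with the coefficients of \<open>P_a\<close>.\<close>
  define q where "q = (\<lambda>i k. if even (i + k) then p (i div 2) (k div 2) else (0::real))"
  define M where "M = (\<lambda>i j. \<Sum>k\<le>i. q i k * g (k + j))"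
  have q1: "q i i = 1" for i
    using assms by (simp add: q_def orth_coeffs_def)
  have M_eq: "M (2 * a + r) j = (\<Sum>l\<le>a. p a l * g (2 * l + r + j))" if "r < 2" for a r j
  proof -
    have "M (2 * a + r) j = (\<Sum>k\<in>(\<lambda>l. 2 * l + r) ` {..a}. q (2 * a + r) k * g (k + j))"
      unfolding M_def
    proof (rule sum.mono_neutral_right)
      have "k \<in> (\<lambda>l. 2 * l + r) ` {..a}" if "k \<le> 2 * a + r" "even (2 * a + r + k)" for k
        using that \<open>r < 2\<close> by (intro image_eqI[of _ _ "k div 2"]) (auto simp: less_2_cases_iff)
      then show "\<forall>k\<in>{..2 * a + r} - (\<lambda>l. 2 * l + r) ` {..a}. q (2 * a + r) k * g (k + j) = 0"
        by (auto simp: q_def)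
    qed auto
    also have "\<dots> = (\<Sum>l\<le>a. q (2 * a + r) (2 * l + r) * g (2 * l + r + j))"
      by (subst sum.reindex) (auto simp: inj_on_def)
    also have "\<dots> = (\<Sum>l\<le>a. p a l * g (2 * l + r + j))"
      using that by (simp add: q_def)
    finally show ?thesis .
  qed
  have even0: "M (2 * a + r) j = 0" if "r < 2" "even (r + j)" for a r j
    using that unfolding M_eq[OF that(1)] by (intro sum.neutral) (auto simp: g_def)
  have odd_eq: "M (2 * a + r) j = (\<Sum>l\<le>a. p a l * c ((r + j) div 2 + l))"
    if "r < 2" "odd (r + j)" for a r j
    unfolding M_eq[OF that(1)]
  proof (intro sum.cong refl)
    fix l
    have "(2 * l + r + j) div 2 = (r + j) div 2 + l"
      by simp
    with that show "p a l * g (2 * l + r + j) = p a l * c ((r + j) div 2 + l)"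
      by (auto simp: g_def)
  qed
  have lower: "M i j = 0" if "j < 2 * a" "2 * a \<le> i" for a i j
  proof (cases "even (i mod 2 + j)")
    case True
    then show ?thesis
      using even0[of "i mod 2" j "i div 2"] by simp
  next
    case False
    \<comment> \<open>Adding \<open>i mod 2\<close> cannot carry the quotient up to
      \<open>a\<close>: for odd \<open>i\<close> the column \<open>j\<close> is even, hence at most
      \<open>2 * a - 2\<close>.\<close>
    have "(i mod 2 + j) div 2 < a"
    proof (cases "even i")
      case True
      with \<open>j < 2 * a\<close> show ?thesis by auto
    next
      case odd: False
      with False have "even j" by (simp add: mod_2_eq_odd)
      with odd \<open>j < 2 * a\<close> show ?thesis by (auto simp: mod_2_eq_odd elim!: evenE)
    qed
    also have "a \<le> i div 2" using that by simp
    finally have "(i mod 2 + j) div 2 < i div 2" .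
    then show ?thesis
      using odd_eq[of "i mod 2" j "i div 2"] False assms by (simp add: orth_coeffs_def)
  qed
  have diag: "M i i = 0" for i
    using even0[of "i mod 2" i "i div 2"] by simp
  have anti: "M (2 * a) (2 * a + 1) = h a" "M (2 * a + 1) (2 * a) = h a" for a
    using odd_eq[of 0 "2 * a + 1" a] odd_eq[of 1 "2 * a" a] assms by (simp_all add: orth_coeffs_def)
  have "hankel_det g N = det (mat N N (\<lambda>(i, j). M i j))" for N
    unfolding hankel_det_def M_def by (rule det_unitriangular_row_ops) (rule q1)
  moreover have "det (mat (2 * n) (2 * n) (\<lambda>(i, j). M i j)) = (-1) ^ n * (\<Prod>a<n. h a)\<^sup>2"
    by (rule det_block_upper_antidiagonal(1)) (fact lower diag anti)+
  moreover have "det (mat (2 * n + 1) (2 * n + 1) (\<lambda>(i, j). M i j)) = 0"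
    by (rule det_block_upper_antidiagonal(2)) (fact lower diag anti)+
  ultimately show "hankel_det (\<lambda>k. if odd k then c (k div 2) else 0) (2 * n) = (-1) ^ n * (\<Prod>a<n. h a)\<^sup>2"
    and "hankel_det (\<lambda>k. if odd k then c (k div 2) else 0) (2 * n + 1) = 0"
    unfolding g_def[symmetric] by (simp_all only:)
qed

section \<open>Continued fractions\<close>

text \<open>The quotients \<open>u (n + 1) / u n\<close> are the tails of the continued fraction, so that
  \<open>f = \<kappa> / (1 - b 0 X - l 0 X\<^sup>2 / (1 - b 1 X - l 1 X\<^sup>2 / \<dots>))\<close>; stating it with the
  \<open>u n\<close> avoids limits. In the Stieltjes case,
  \<open>f = \<kappa> / (1 - a 0 X / (1 - a 1 X / \<dots>))\<close>.\<close>

definition has_jfrac :: "real fps \<Rightarrow> real \<Rightarrow> (nat \<Rightarrow> real) \<Rightarrow> (nat \<Rightarrow> real) \<Rightarrow> bool" where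
  "has_jfrac f \<kappa> b l \<longleftrightarrow>
     (\<exists>u. (\<forall>n. fps_nth (u n) 0 = 1) \<and> f * u 0 = fps_const \<kappa> * u (Suc 0) \<and>
          (\<forall>n. u n = (1 - fps_const (b n) * fps_X) * u (Suc n)
                     - fps_const (l n) * fps_X\<^sup>2 * u (Suc (Suc n))))"

definition has_sfrac :: "real fps \<Rightarrow> real \<Rightarrow> (nat \<Rightarrow> real) \<Rightarrow> bool" where
  "has_sfrac f \<kappa> a \<longleftrightarrow>
     (\<exists>w. (\<forall>n. fps_nth (w n) 0 = 1) \<and> f * w 0 = fps_const \<kappa> * w (Suc 0) \<and>
          (\<forall>n. w n = w (Suc n) - fps_const (a n) * fps_X * w (Suc (Suc n))))"

text \<open>These are the polynomials \<open>X^n P_n(1/X)\<close> for the monic orthogonal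
  \<open>P_n\<close>; working with the reversed form keeps everything inside power series in
  \<open>X\<close>.\<close>

fun pade_denom :: "(nat \<Rightarrow> real) \<Rightarrow> (nat \<Rightarrow> real) \<Rightarrow> nat \<Rightarrow> real fps" where
  "pade_denom b l 0 = 1"
| "pade_denom b l (Suc 0) = 1 - fps_const (b 0) * fps_X"
| "pade_denom b l (Suc (Suc n)) = (1 - fps_const (b (Suc n)) * fps_X) * pade_denom b l (Suc n)
     - fps_const (l n) * fps_X\<^sup>2 * pade_denom b l n"

fun pade_num :: "real \<Rightarrow> (nat \<Rightarrow> real) \<Rightarrow> (nat \<Rightarrow> real) \<Rightarrow> nat \<Rightarrow> real fps" where
  "pade_num \<kappa> b l 0 = 0"
| "pade_num \<kappa> b l (Suc 0) = fps_const \<kappa>"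
| "pade_num \<kappa> b l (Suc (Suc n)) = (1 - fps_const (b (Suc n)) * fps_X) * pade_num \<kappa> b l (Suc n)
     - fps_const (l n) * fps_X\<^sup>2 * pade_num \<kappa> b l n"

lemma fps_nth_one_minus_X_mult:
  "fps_nth ((1 - fps_const (b::real) * fps_X) * f) (Suc m) = fps_nth f (Suc m) - b * fps_nth f m"
  by (simp add: algebra_simps)

lemma fps_nth_X2_mult:
  "fps_nth (fps_const (b::real) * fps_X\<^sup>2 * f) m = (if m < 2 then 0 else b * fps_nth f (m - 2))"
  by (simp add: fps_X_power_mult_nth mult.assoc)

lemma pade_denom_nth:
  "fps_nth (pade_denom b l n) 0 = 1" "m > n \<Longrightarrow> fps_nth (pade_denom b l n) m = 0"
proof -
  show "fps_nth (pade_denom b l n) 0 = 1"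
    by (induction b l n rule: pade_denom.induct) (simp_all add: power2_eq_square)
  show "m > n \<Longrightarrow> fps_nth (pade_denom b l n) m = 0"
  proof (induction b l n arbitrary: m rule: pade_denom.induct)
    case (3 b l n)
    then show ?case
      by (cases m) (auto simp: fps_nth_one_minus_X_mult fps_nth_X2_mult)
  qed auto
qed

lemma pade_num_nth: "m \<ge> n \<Longrightarrow> fps_nth (pade_num \<kappa> b l n) m = 0"
proof (induction \<kappa> b l n arbitrary: m rule: pade_num.induct)
  case (3 \<kappa> b l n)
  then show ?case
    by (cases m) (auto simp: fps_nth_one_minus_X_mult fps_nth_X2_mult)
qed auto

text \<open>Both sides obey the same three-term recurrence in \<open>n\<close>: the left by
  definition of the convergents, the right because the recurrence for \<open>u\<close> expresses its
  next term by the two preceding ones.\<close>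

lemma pade_remainder:
  assumes "f * u 0 = fps_const \<kappa> * u (Suc 0)"
    and rec: "\<And>n. u n = (1 - fps_const (b n) * fps_X) * u (Suc n)
                        - fps_const (l n) * fps_X\<^sup>2 * u (Suc (Suc n))"
  shows "(pade_denom b l n * f - pade_num \<kappa> b l n) * u 0 =
    fps_X ^ (2 * n) * fps_const (\<kappa> * (\<Prod>k<n. l k)) * u (Suc n)"
proof (induction n rule: induct_nat_012)
  case 0
  then show ?case using assms(1) by simp
next
  case 1
  have "(pade_denom b l 1 * f - pade_num \<kappa> b l 1) * u 0 =
     (1 - fps_const (b 0) * fps_X) * (f * u 0) - fps_const \<kappa> * u 0"
    by (simp add: algebra_simps)
  also have "\<dots> = fps_const \<kappa> * ((1 - fps_const (b 0) * fps_X) * u (Suc 0) - u 0)"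
    by (simp add: assms(1) algebra_simps)
  also have "\<dots> = fps_const \<kappa> * (fps_const (l 0) * fps_X\<^sup>2 * u (Suc (Suc 0)))"
    by (subst rec[of 0]) simp
  finally show ?case
    by (simp add: algebra_simps power2_eq_square flip: fps_const_mult)
next
  case (ge2 n)
  define h where "h = fps_const (\<kappa> * (\<Prod>k<n. l k))"
  have "(pade_denom b l (Suc (Suc n)) * f - pade_num \<kappa> b l (Suc (Suc n))) * u 0 =
     (1 - fps_const (b (Suc n)) * fps_X) * ((pade_denom b l (Suc n) * f - pade_num \<kappa> b l (Suc n)) * u 0)
     - fps_const (l n) * fps_X\<^sup>2 * ((pade_denom b l n * f - pade_num \<kappa> b l n) * u 0)"
    by (simp add: algebra_simps)
  also have "\<dots> = fps_X ^ (2 * n + 2) * fps_const (l n) * h *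
     ((1 - fps_const (b (Suc n)) * fps_X) * u (Suc (Suc n)) - u (Suc n))"
    unfolding ge2
    by (simp add: h_def algebra_simps power_add power2_eq_square flip: fps_const_mult)
  also have "(1 - fps_const (b (Suc n)) * fps_X) * u (Suc (Suc n)) - u (Suc n) =
     fps_const (l (Suc n)) * fps_X\<^sup>2 * u (Suc (Suc (Suc n)))"
    by (subst rec[of "Suc n"]) simp
  finally show ?case
    by (simp add: h_def algebra_simps power_add power2_eq_square flip: fps_const_mult)
qed

text \<open>In the product of \<open>f\<close> with the \<open>n\<close>-th denominator, the
  numerator only reaches degrees below \<open>n\<close> and the remainder starts at degree
  \<open>2 * n\<close>. The vanishing coefficients in between are the orthogonality relations; the
  one at \<open>2 * n\<close> is the norm. Dividing by \<open>u 0\<close> keeps that leading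
  coefficient, as \<open>u 0\<close> has constant term 1.\<close>

lemma has_jfrac_imp_orth_coeffs:
  assumes "has_jfrac f \<kappa> b l"
  shows "orth_coeffs (fps_nth f) (\<lambda>n j. fps_nth (pade_denom b l n) (n - j)) (\<lambda>n. \<kappa> * (\<Prod>k<n. l k))"
proof -
  from assms obtain u where u: "\<And>n. fps_nth (u n) 0 = 1" "f * u 0 = fps_const \<kappa> * u (Suc 0)"
    "\<And>n. u n = (1 - fps_const (b n) * fps_X) * u (Suc n) - fps_const (l n) * fps_X\<^sup>2 * u (Suc (Suc n))"
    unfolding has_jfrac_def by blast
  have coeff: "(\<Sum>j\<le>n. fps_nth (pade_denom b l n) (n - j) * fps_nth f (i + j)) =
     (if i < n then 0 else \<kappa> * (\<Prod>k<n. l k))" if "i \<le> n" for n i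
  proof -
    have "(\<Sum>j\<le>n. fps_nth (pade_denom b l n) (n - j) * fps_nth f (i + j)) =
       (\<Sum>j\<le>n. fps_nth (pade_denom b l n) j * fps_nth f (n + i - j))"
      by (rule sum.reindex_bij_witness[of _ "\<lambda>j. n - j" "\<lambda>j. n - j"]) (auto intro!: arg_cong2[where f = "(*)"] arg_cong[where f = "fps_nth f"])
    also have "\<dots> = fps_nth (pade_denom b l n * f) (n + i)"
      unfolding fps_mult_nth
      by (rule sum.mono_neutral_left) (auto simp: pade_denom_nth)
    also have "\<dots> = fps_nth (pade_denom b l n * f - pade_num \<kappa> b l n) (n + i)"
      by (simp add: pade_num_nth)
    also have "pade_denom b l n * f - pade_num \<kappa> b l n =
       (pade_denom b l n * f - pade_num \<kappa> b l n) * u 0 * inverse (u 0)"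
      using u(1)[of 0] by (simp add: mult.assoc inverse_mult_eq_1')
    also have "\<dots> = fps_X ^ (2 * n) * (fps_const (\<kappa> * (\<Prod>k<n. l k)) * u (Suc n) * inverse (u 0))"
      by (subst pade_remainder[of f u, OF u(2,3)]) (simp add: mult.assoc)
    also have "fps_nth \<dots> (n + i) = (if i < n then 0 else \<kappa> * (\<Prod>k<n. l k))"
      using that u(1)[of 0] u(1)[of "Suc n"] by (auto simp: fps_X_power_mult_nth fps_mult_nth_0)
    finally show ?thesis .
  qed
  show ?thesis
    unfolding orth_coeffs_def using coeff by (auto simp: pade_denom_nth)
qed

lemma hankel_det_jfrac:
  assumes "has_jfrac f \<kappa> b l"
  shows "hankel_det (fps_nth f) N = (\<Prod>n<N. \<kappa> * (\<Prod>k<n. l k))"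
  by (rule hankel_det_orth[OF has_jfrac_imp_orth_coeffs[OF assms]])

section \<open>Contractions of Stieltjes fractions\<close>

text \<open>Eliminates \<open>w (n + 1)\<close> and \<open>w (n + 3)\<close> from the recurrences at
  \<open>n\<close>, \<open>n + 1\<close> and \<open>n + 2\<close>.\<close>

lemma sfrac_skip:
  fixes w :: "nat \<Rightarrow> real fps"
  assumes rec: "\<And>n. w n = w (Suc n) - fps_const (a n) * fps_X * w (Suc (Suc n))"
  shows "w n = (1 - fps_const (a n + a (Suc n)) * fps_X) * w (Suc (Suc n))
     - fps_const (a (Suc n) * a (Suc (Suc n))) * fps_X\<^sup>2 * w (Suc (Suc (Suc (Suc n))))"
proof -
  have W1: "w (Suc n) = w (Suc (Suc n)) - fps_const (a (Suc n)) * fps_X * w (Suc (Suc (Suc n)))"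
    by (rule rec)
  have W3: "w (Suc (Suc (Suc n))) =
      w (Suc (Suc n)) + fps_const (a (Suc (Suc n))) * fps_X * w (Suc (Suc (Suc (Suc n))))"
    by (subst (2) rec) simp
  have W0: "w n = w (Suc n) - fps_const (a n) * fps_X * w (Suc (Suc n))"
    by (rule rec)
  show ?thesis
    unfolding W0 W1 W3
    by (simp add: algebra_simps power2_eq_square flip: fps_const_mult fps_const_add)
qed

text \<open>The even contraction: it keeps \<open>w 0, w 1, w 3, w 5, ...\<close>. The irregular
  first step is the reason for the exceptional value at \<open>n = 0\<close>.\<close>

lemma has_sfrac_imp_has_jfrac:
  assumes "has_sfrac f \<kappa> a"
  shows "has_jfrac f \<kappa> (\<lambda>n. a (2 * n) + (if n = 0 then 0 else a (2 * n - 1)))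
           (\<lambda>n. a (2 * n) * a (Suc (2 * n)))"
proof -
  from assms obtain w where w: "\<And>n. fps_nth (w n) 0 = 1" "f * w 0 = fps_const \<kappa> * w (Suc 0)"
    and rec: "\<And>n. w n = w (Suc n) - fps_const (a n) * fps_X * w (Suc (Suc n))"
    unfolding has_sfrac_def by blast
  \<comment> \<open>Truncated subtraction gives \<open>u 0 = w 0\<close>.\<close>
  define u where "u = (\<lambda>n. w (2 * n - 1))"
  have u0: "u 0 = w 0" and u_Suc: "u (Suc n) = w (Suc (2 * n))" for n
    by (simp_all add: u_def)
  show ?thesis
    unfolding has_jfrac_def
  proof (intro exI[of _ u] conjI allI)
    show "fps_nth (u n) 0 = 1" for n
      by (simp add: u_def w)
    show "f * u 0 = fps_const \<kappa> * u (Suc 0)"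
      by (simp add: u_def w)
    fix n
    show "u n = (1 - fps_const (a (2 * n) + (if n = 0 then 0 else a (2 * n - 1))) * fps_X) * u (Suc n)
        - fps_const (a (2 * n) * a (Suc (2 * n))) * fps_X\<^sup>2 * u (Suc (Suc n))"
    proof (cases n)
      case 0
      have W2: "w (Suc (Suc 0)) = w (Suc 0) + fps_const (a (Suc 0)) * fps_X * w (Suc (Suc (Suc 0)))"
        by (subst (2) rec) simp
      have "w 0 = w (Suc 0) - fps_const (a 0) * fps_X * w (Suc (Suc 0))"
        by (rule rec)
      also have "\<dots> = (1 - fps_const (a 0) * fps_X) * w (Suc 0)
          - fps_const (a 0 * a (Suc 0)) * fps_X\<^sup>2 * w (Suc (Suc (Suc 0)))"
        unfolding W2 by (simp add: algebra_simps power2_eq_square flip: fps_const_mult)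
      finally show ?thesis
        using u_Suc[of 0] u_Suc[of "Suc 0"] by (simp add: 0 u0 numeral_3_eq_3)
    next
      case (Suc m)
      show ?thesis
        using sfrac_skip[of w a "Suc (2 * m)", OF rec] u_Suc[of m] u_Suc[of "Suc m"] u_Suc[of "Suc (Suc m)"]
        by (simp add: Suc add.commute)
    qed
  qed
qed

text \<open>\<open>\<kappa>\<close> is the constant term of \<open>f\<close>. Removing it leaves
  \<open>\<kappa> * (w 1 - w 0)\<close>, which by the first recurrence is
  \<open>\<kappa> * a 0 * X * w 2\<close>; then \<open>X\<close> cancels.\<close>

lemma sfrac_shift_mult:
  fixes w :: "nat \<Rightarrow> real fps"
  assumes "\<And>n. fps_nth (w n) 0 = 1" "f * w 0 = fps_const \<kappa> * w (Suc 0)"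
    and rec: "\<And>n. w n = w (Suc n) - fps_const (a n) * fps_X * w (Suc (Suc n))"
  shows "fps_shift 1 f * w 0 = fps_const (\<kappa> * a 0) * w (Suc (Suc 0))"
proof -
  have "fps_nth (f * w 0) 0 = fps_nth (fps_const \<kappa> * w (Suc 0)) 0"
    by (simp only: assms(2))
  then have f0: "fps_nth f 0 = \<kappa>"
    by (simp add: assms(1))
  have f: "f = fps_const \<kappa> + fps_X * fps_shift 1 f"
  proof (rule fps_ext)
    show "fps_nth f n = fps_nth (fps_const \<kappa> + fps_X * fps_shift 1 f) n" for n
      by (cases n) (simp_all add: f0)
  qed
  have "f * w 0 = fps_const \<kappa> * w 0 + fps_X * (fps_shift 1 f * w 0)"
    by (subst f) (simp add: algebra_simps)
  moreover have "w (Suc 0) = w 0 + fps_const (a 0) * fps_X * w (Suc (Suc 0))"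
    by (subst (2) rec) simp
  ultimately have "fps_X * (fps_shift 1 f * w 0) = fps_X * (fps_const (\<kappa> * a 0) * w (Suc (Suc 0)))"
    unfolding assms(2) by (simp add: algebra_simps flip: fps_const_mult)
  then show ?thesis
    by simp
qed

text \<open>The odd contraction: it keeps \<open>w 0, w 2, w 4, ...\<close>, so every step is
  regular.\<close>

lemma has_sfrac_imp_has_jfrac_shift:
  assumes "has_sfrac f \<kappa> a"
  shows "has_jfrac (fps_shift 1 f) (\<kappa> * a 0) (\<lambda>n. a (2 * n) + a (Suc (2 * n)))
           (\<lambda>n. a (Suc (2 * n)) * a (Suc (Suc (2 * n))))"
proof -
  from assms obtain w where w: "\<And>n. fps_nth (w n) 0 = 1" "f * w 0 = fps_const \<kappa> * w (Suc 0)"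
    "\<And>n. w n = w (Suc n) - fps_const (a n) * fps_X * w (Suc (Suc n))"
    unfolding has_sfrac_def by blast
  show ?thesis
    unfolding has_jfrac_def
  proof (intro exI[of _ "\<lambda>n. w (2 * n)"] conjI allI)
    show "fps_nth (w (2 * n)) 0 = 1" for n
      by (rule w)
    show "fps_shift 1 f * w (2 * 0) = fps_const (\<kappa> * a 0) * w (2 * Suc 0)"
      using sfrac_shift_mult[of w f, OF w] by (simp add: numeral_2_eq_2)
    show "w (2 * n) = (1 - fps_const (a (2 * n) + a (Suc (2 * n))) * fps_X) * w (2 * Suc n)
        - fps_const (a (Suc (2 * n)) * a (Suc (Suc (2 * n)))) * fps_X\<^sup>2 * w (2 * Suc (Suc n))" for n
      using sfrac_skip[of w a "2 * n", OF w(3)] by simp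
  qed
qed

text \<open>The hypotheses on the coefficients are the rhombus rules of the quotient-difference
  algorithm.\<close>

lemma has_sfrac_shift:
  assumes "has_sfrac f \<kappa> a"
    and sum0: "a' 0 = a 0 + a (Suc 0)"
    and sum: "\<And>n. a' (Suc (2 * n)) + a' (Suc (Suc (2 * n))) =
                   a (Suc (Suc (2 * n))) + a (Suc (Suc (Suc (2 * n))))"
    and prod: "\<And>n. a' (2 * n) * a' (Suc (2 * n)) = a (Suc (2 * n)) * a (Suc (Suc (2 * n)))"
  shows "has_sfrac (fps_shift 1 f) (\<kappa> * a 0) a'"
proof -
  from assms(1) obtain w where w: "\<And>n. fps_nth (w n) 0 = 1" "f * w 0 = fps_const \<kappa> * w (Suc 0)"
    "\<And>n. w n = w (Suc n) - fps_const (a n) * fps_X * w (Suc (Suc n))"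
    unfolding has_sfrac_def by blast
  \<comment> \<open>The choice is forced. The shifted series has Jacobi tails built from
    \<open>w (2 * n)\<close>, and the even contraction of the new fraction keeps
    \<open>v 0, v 1, v 3, ...\<close>, so \<open>v (2 * n + 1)\<close> must be
    \<open>w (2 * n + 2)\<close>. The other entries are solved from the recurrence at odd indices;
    at even indices the recurrence says that the two contractions agree.\<close>
  define v where "v = (\<lambda>n. if n = 0 then w 0 else if odd n then w (Suc n)
      else w n + fps_const (a' (n - 1)) * fps_X * w (Suc (Suc n)))"
  have v0: "v 0 = w 0" and v_odd: "v (Suc (2 * n)) = w (Suc (Suc (2 * n)))"
    and v_even: "v (Suc (Suc (2 * n))) = w (Suc (Suc (2 * n)))
      + fps_const (a' (Suc (2 * n))) * fps_X * w (Suc (Suc (Suc (Suc (2 * n)))))" for n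
    by (simp_all add: v_def)
  show ?thesis
    unfolding has_sfrac_def
  proof (intro exI[of _ v] conjI allI)
    show "fps_nth (v n) 0 = 1" for n
      by (simp add: v_def w(1))
    show "fps_shift 1 f * v 0 = fps_const (\<kappa> * a 0) * v (Suc 0)"
      using sfrac_shift_mult[of w f, OF w] v_odd[of 0] by (simp add: v0)
    fix n :: nat
    consider "n = 0" | m where "n = Suc (2 * m)" | m where "n = Suc (Suc (2 * m))"
    proof (cases "even n")
      case True
      then obtain k where "n = 2 * k" by blast
      with that show thesis by (cases k) auto
    next
      case False
      with that show thesis by (auto elim: oddE)
    qed
    then show "v n = v (Suc n) - fps_const (a' n) * fps_X * v (Suc (Suc n))"
    proof cases
      case 1
      have "w 0 = (1 - fps_const (a' 0) * fps_X) * w (Suc (Suc 0))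
          - fps_const (a' 0 * a' (Suc 0)) * fps_X\<^sup>2 * w (Suc (Suc (Suc (Suc 0))))"
        using sfrac_skip[of w a 0, OF w(3)] sum0 prod[of 0] by simp
      then show ?thesis
        using v_odd[of 0] v_even[of 0] 1
        by (simp add: v0 algebra_simps power2_eq_square flip: fps_const_mult)
    next
      case (2 m)
      show ?thesis
        unfolding 2 v_odd v_even using v_odd[of "Suc m"] by simp
    next
      case (3 m)
      have "w (Suc (Suc (2 * m))) = (1 - fps_const (a' (Suc (2 * m)) + a' (Suc (Suc (2 * m)))) * fps_X)
            * w (Suc (Suc (Suc (Suc (2 * m)))))
          - fps_const (a' (Suc (Suc (2 * m))) * a' (Suc (Suc (Suc (2 * m))))) * fps_X\<^sup>2
            * w (Suc (Suc (Suc (Suc (Suc (Suc (2 * m)))))))"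
        using sfrac_skip[of w a "Suc (Suc (2 * m))", OF w(3)] sum[of m] prod[of "Suc m"] by simp
      moreover have "v (Suc (Suc (Suc (2 * m)))) = w (Suc (Suc (Suc (Suc (2 * m)))))"
        "v (Suc (Suc (Suc (Suc (2 * m))))) = w (Suc (Suc (Suc (Suc (2 * m)))))
         + fps_const (a' (Suc (Suc (Suc (2 * m))))) * fps_X * w (Suc (Suc (Suc (Suc (Suc (Suc (2 * m)))))))"
        using v_odd[of "Suc m"] v_even[of "Suc m"] by simp_all
      ultimately show ?thesis
        unfolding 3 v_even
        by (simp add: algebra_simps power2_eq_square flip: fps_const_mult fps_const_add)
    qed
  qed
qed

section \<open>Substituting the square of the variable\<close>

lemma fps_nth_compose_X2:
  "fps_nth (f oo fps_X\<^sup>2) n = (if even n then fps_nth f (n div 2) else (0::real))"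
proof -
  have "fps_nth (f oo fps_X\<^sup>2) n = (\<Sum>i=0..n. if n = 2 * i then fps_nth f i else 0)"
    unfolding fps_compose_nth
    by (intro sum.cong refl) (simp add: power_mult[symmetric])
  also have "\<dots> = (\<Sum>i=0..n. if i = n div 2 then (if even n then fps_nth f (n div 2) else 0) else 0)"
    by (intro sum.cong refl) auto
  also have "\<dots> = (if even n then fps_nth f (n div 2) else 0)"
    by simp
  finally show ?thesis .
qed

lemma fps_compose_X2_mult: "(f * g) oo fps_X\<^sup>2 = (f oo fps_X\<^sup>2) * (g oo (fps_X\<^sup>2 :: real fps))"
  by (rule fps_compose_mult_distrib) simp

text \<open>Once \<open>X\<close> is replaced by its square, the Stieltjes recurrence is already a
  Jacobi recurrence, so the partial numerators enter singly and not in pairs.\<close>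

lemma has_sfrac_imp_has_jfrac_compose_X2:
  assumes "has_sfrac f \<kappa> a"
  shows "has_jfrac (f oo fps_X\<^sup>2) \<kappa> (\<lambda>_. 0) a"
proof -
  from assms obtain w where w: "\<And>n. fps_nth (w n) 0 = 1" "f * w 0 = fps_const \<kappa> * w (Suc 0)"
    and rec: "\<And>n. w n = w (Suc n) - fps_const (a n) * fps_X * w (Suc (Suc n))"
    unfolding has_sfrac_def by blast
  show ?thesis
    unfolding has_jfrac_def
  proof (intro exI[of _ "\<lambda>n. w n oo fps_X\<^sup>2"] conjI allI)
    show "fps_nth (w n oo fps_X\<^sup>2) 0 = 1" for n
      by (simp add: w)
    show "(f oo fps_X\<^sup>2) * (w 0 oo fps_X\<^sup>2) = fps_const \<kappa> * (w (Suc 0) oo fps_X\<^sup>2)"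
      using arg_cong[OF w(2), of "\<lambda>f. f oo fps_X\<^sup>2"] by (simp add: fps_compose_X2_mult)
    show "w n oo fps_X\<^sup>2 = (1 - fps_const 0 * fps_X) * (w (Suc n) oo fps_X\<^sup>2)
        - fps_const (a n) * fps_X\<^sup>2 * (w (Suc (Suc n)) oo fps_X\<^sup>2)" for n
      by (subst rec) (simp add: fps_compose_sub_distrib fps_compose_X2_mult)
  qed
qed

text \<open>The letters are those of the quotient-difference table. The split by parity fits its
  rules and the closed forms, which differ in the two columns.\<close>

definition interleave :: "(nat \<Rightarrow> 'a) \<Rightarrow> (nat \<Rightarrow> 'a) \<Rightarrow> nat \<Rightarrow> 'a" where
  "interleave q e n = (if even n then q (n div 2) else e (n div 2))"

lemma interleave_simps [simp]:
  "interleave q e 0 = q 0"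
  "interleave q e (Suc 0) = e 0"
  "interleave q e (2 * n) = q n"
  "interleave q e (Suc (2 * n)) = e n"
  "interleave q e (Suc (Suc n)) = interleave (\<lambda>k. q (Suc k)) (\<lambda>k. e (Suc k)) n"
  by (simp_all add: interleave_def)

lemma has_jfrac_of_qd:
  assumes "has_sfrac f \<kappa> (interleave q e)"
  obtains b where "has_jfrac f \<kappa> b (\<lambda>n. q n * e n)"
  using has_sfrac_imp_has_jfrac[OF assms] by simp

lemma has_jfrac_shift_of_qd:
  assumes "has_sfrac f \<kappa> (interleave q e)"
  obtains b where "has_jfrac (fps_shift 1 f) (\<kappa> * q 0) b (\<lambda>n. e n * q (Suc n))"
  using has_sfrac_imp_has_jfrac_shift[OF assms] by simp

lemma has_sfrac_shift_qd:
  assumes "has_sfrac f \<kappa> (interleave q e)"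
    and "q' 0 = q 0 + e 0"
    and "\<And>n. e' n + q' (Suc n) = q (Suc n) + e (Suc n)"
    and "\<And>n. q' n * e' n = e n * q (Suc n)"
    and "\<kappa>' = \<kappa> * q 0"
  shows "has_sfrac (fps_shift 1 f) \<kappa>' (interleave q' e')"
  using has_sfrac_shift[OF assms(1), of "interleave q' e'"] assms(2-) by simp

text \<open>In the following criteria \<open>g n\<close> is the ratio of the determinants of sizes
  \<open>n + 1\<close> and \<open>n\<close>.\<close>

lemma hankel_det_unique:
  assumes "has_jfrac f \<kappa> b l" "g 0 = \<kappa>" "\<And>n. g (Suc n) = g n * l n"
    and "K 0 = 1" "\<And>n. K (Suc n) = K n * g n"
  shows "hankel_det (fps_nth f) n = K n"
proof -
  have g: "g n = \<kappa> * (\<Prod>k<n. l k)" for n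
    by (induction n) (simp_all add: assms(2,3))
  have "K n = (\<Prod>k<n. g k)"
    by (induction n) (simp_all add: assms(4,5))
  then show ?thesis
    by (simp add: hankel_det_jfrac[OF assms(1)] g)
qed

lemma hankel_det_compose_X2:
  assumes "has_sfrac f \<kappa> (interleave q e)" "g 0 = \<kappa>"
    and "\<And>n. g (Suc n) = g n * interleave q e n"
    and "K 0 = 1" "\<And>n. K (Suc n) = K n * g n"
  shows "hankel_det (fps_nth (f oo fps_X\<^sup>2)) n = K n"
  by (rule hankel_det_unique[OF has_sfrac_imp_has_jfrac_compose_X2]) (fact assms)+

lemma hankel_det_sfrac:
  assumes "has_sfrac f \<kappa> (interleave q e)" "g 0 = \<kappa>" "\<And>n. g (Suc n) = g n * (q n * e n)"
    and "K 0 = 1" "\<And>n. K (Suc n) = K n * g n"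
  shows "hankel_det (fps_nth f) n = K n"
proof -
  obtain b where "has_jfrac f \<kappa> b (\<lambda>n. q n * e n)"
    using has_jfrac_of_qd[OF assms(1)] .
  then show ?thesis
    by (rule hankel_det_unique) (fact assms)+
qed

text \<open>Uses the odd contraction, so a Stieltjes fraction of the shifted series itself need not
  be found.\<close>

lemma hankel_det_sfrac_shift:
  assumes "has_sfrac f \<kappa> (interleave q e)" "g 0 = \<kappa> * q 0" "\<And>n. g (Suc n) = g n * (e n * q (Suc n))"
    and "K 0 = 1" "\<And>n. K (Suc n) = K n * g n"
  shows "hankel_det (fps_nth (fps_shift 1 f)) n = K n"
proof -
  obtain b where "has_jfrac (fps_shift 1 f) (\<kappa> * q 0) b (\<lambda>n. e n * q (Suc n))"
    using has_jfrac_shift_of_qd[OF assms(1)] .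
  then show ?thesis
    by (rule hankel_det_unique) (fact assms)+
qed

lemma hankel_det_odd_interleaved_sfrac:
  assumes "has_sfrac f \<kappa> a"
  shows "hankel_det (\<lambda>k. if odd k then fps_nth f (k div 2) else 0) (2 * n) =
           (-1) ^ n * (hankel_det (fps_nth f) n)\<^sup>2"
    and "hankel_det (\<lambda>k. if odd k then fps_nth f (k div 2) else 0) (2 * n + 1) = 0"
  using hankel_det_odd_interleaved[OF has_jfrac_imp_orth_coeffs[OF has_sfrac_imp_has_jfrac[OF assms]], of n]
  by (simp_all add: hankel_det_jfrac[OF has_sfrac_imp_has_jfrac[OF assms]])

section \<open>The tangent and Euler series\<close>

text \<open>The hypergeometric series 0F1(; n + 1/2; -t X), a normalised Bessel function of order
  \<open>n - 1/2\<close>. Orders -1/2 and 1/2 give cosine and sine.\<close>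

definition bessel_fps :: "real \<Rightarrow> nat \<Rightarrow> real fps" where
  "bessel_fps t n = Abs_fps (\<lambda>m. (- t) ^ m / (fact m * pochhammer (real n + 1 / 2) m))"

lemma bessel_fps_nth_0 [simp]: "fps_nth (bessel_fps t n) 0 = 1"
  by (simp add: bessel_fps_def)

text \<open>The contiguous relation of 0F1. For the coefficient of \<open>X^m\<close> with
  \<open>m > 0\<close> and \<open>\<nu> = n + 1/2\<close> it is \<open>1 / pochhammer \<nu> m - 1 /
  pochhammer (\<nu> + 1) m = m / (\<nu> * pochhammer (\<nu> + 1) m)\<close>, where \<open>m\<close>
  cancels against the factorial.\<close>

lemma bessel_fps_rec:
  "bessel_fps t n = bessel_fps t (Suc n)
     - fps_const (4 * t / ((2 * real n + 1) * (2 * real n + 3))) * fps_X * bessel_fps t (Suc (Suc n))"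
proof (rule fps_ext)
  fix m
  show "fps_nth (bessel_fps t n) m = fps_nth (bessel_fps t (Suc n)
     - fps_const (4 * t / ((2 * real n + 1) * (2 * real n + 3))) * fps_X * bessel_fps t (Suc (Suc n))) m"
  proof (cases m)
    case 0
    then show ?thesis by (simp add: mult.assoc)
  next
    case (Suc k)
    define \<nu> where "\<nu> = real n + 1 / 2"
    define P where "P = pochhammer (\<nu> + 2) k"
    have pos: "\<nu> > 0" "P > 0"
      by (auto simp: \<nu>_def P_def intro!: pochhammer_pos)
    have P1: "pochhammer (\<nu> + 1) (Suc k) = (\<nu> + 1) * P"
      by (simp add: pochhammer_rec P_def add.assoc)
    then have "pochhammer (\<nu> + 1) k = (\<nu> + 1) * P / (\<nu> + 1 + k)"
      using pos by (simp add: pochhammer_Suc field_simps)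
    then have P0: "pochhammer \<nu> (Suc k) = \<nu> * (\<nu> + 1) * P / (\<nu> + 1 + k)"
      by (simp add: pochhammer_rec)
    have pos': "\<nu> + 1 + real k > 0" "\<nu> + 1 > 0" using pos by simp_all
    have *: "x / (y * (\<nu> * (\<nu> + 1) * P / s)) = x * s / (y * \<nu> * (\<nu> + 1) * P)" for x y s :: real
      by simp
    have "(- t) ^ Suc k / (fact (Suc k) * pochhammer \<nu> (Suc k)) =
      (- t) ^ Suc k * (\<nu> + 1 + k) / (fact (Suc k) * \<nu> * (\<nu> + 1) * P)"
      unfolding P0 by (rule *)
    also have "\<dots> = (- t) ^ Suc k / (fact (Suc k) * pochhammer (\<nu> + 1) (Suc k))
        - t / (\<nu> * (\<nu> + 1)) * ((- t) ^ k / (fact k * P))"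
      unfolding P1 using pos pos' by (simp add: divide_simps fact_Suc) (simp add: algebra_simps)
    finally have "(- t) ^ Suc k / (fact (Suc k) * pochhammer \<nu> (Suc k)) =
        (- t) ^ Suc k / (fact (Suc k) * pochhammer (\<nu> + 1) (Suc k))
        - t / (\<nu> * (\<nu> + 1)) * ((- t) ^ k / (fact k * P))" .
    moreover have "real (Suc n) + 1 / 2 = \<nu> + 1" "real (Suc (Suc n)) + 1 / 2 = \<nu> + 2" "real n + 1 / 2 = \<nu>"
      by (simp_all add: \<nu>_def)
    moreover have "4 * t / ((2 * real n + 1) * (2 * real n + 3)) = t / (\<nu> * (\<nu> + 1))"
      by (simp add: \<nu>_def field_simps)
    ultimately show ?thesis
      by (simp only: Suc bessel_fps_def fps_sub_nth fps_mult_left_const_nth mult.assoc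
            fps_X_mult_nth fps_nth_Abs_fps P_def) simp
  qed
qed

lemma fps_cos_bessel: "fps_cos c = bessel_fps (c\<^sup>2 / 4) 0 oo fps_X\<^sup>2"
proof (rule fps_ext)
  fix n
  show "fps_nth (fps_cos c) n = fps_nth (bessel_fps (c\<^sup>2 / 4) 0 oo fps_X\<^sup>2) n"
  proof (cases "even n")
    case True
    then obtain m where "n = 2 * m" by blast
    then show ?thesis
      by (simp add: fps_nth_compose_X2 fps_cos_def bessel_fps_def fact_double power_mult
            power_mult_distrib power_divide power_minus[of "c\<^sup>2 / 4"])
  qed (simp add: fps_nth_compose_X2 fps_cos_def)
qed

lemma fps_sin_bessel: "fps_sin c = fps_const c * fps_X * (bessel_fps (c\<^sup>2 / 4) 1 oo fps_X\<^sup>2)"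
proof (rule fps_ext)
  fix n
  show "fps_nth (fps_sin c) n = fps_nth (fps_const c * fps_X * (bessel_fps (c\<^sup>2 / 4) 1 oo fps_X\<^sup>2)) n"
  proof (cases "even n")
    case True
    then show ?thesis
      by (cases n) (simp_all add: fps_nth_compose_X2 fps_sin_def mult.assoc)
  next
    case False
    then obtain m where n: "n = Suc (2 * m)" by (auto elim: oddE)
    \<comment> \<open>Moving the base from 1/2 to 3/2 turns the duplication formula for
      \<open>(2 * m)!\<close> into one for \<open>(2 * m + 1)!\<close>.\<close>
    have "pochhammer (3 / 2) m = (1 + 2 * real m) * pochhammer (1 / 2) m"
      using pochhammer_rec[of "1/2::real" m] pochhammer_Suc[of "1/2::real" m] by (simp add: field_simps)
    then have fact: "fact (Suc (2 * m)) = 4 ^ m * ((fact m :: real) * pochhammer (3 / 2) m)"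
      by (simp add: fact_double[of m, where ?'a = real] power_mult)
    have power: "c ^ Suc (2 * m) = c * (c\<^sup>2) ^ m"
      by (simp add: power_mult)
    have "(- 1) ^ m * c ^ Suc (2 * m) / fact (Suc (2 * m)) =
        c * ((- (c\<^sup>2 / 4)) ^ m / (fact m * pochhammer (3 / 2) m))"
      unfolding fact power by (simp add: power_divide power_minus[of "c\<^sup>2 / 4"])
    then show ?thesis
      by (simp add: n fps_nth_compose_X2 fps_sin_def bessel_fps_def mult.assoc del: fact_Suc)
  qed
qed

section \<open>The tangent series\<close>

definition tan_fps :: "real fps" where
  "tan_fps = Abs_fps (\<lambda>k. euler_coeff (2 * k + 1))"

lemma euler_coeff_eq: "euler_coeff n = fps_nth (fps_tan 1 + inverse (fps_cos 1)) n"
  by (simp add: euler_coeff_def euler_number_def)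

lemma tan_fps_mult: "tan_fps * bessel_fps (1 / 4) 0 = bessel_fps (1 / 4) 1"
proof -
  define B where "B = bessel_fps (1 / 4)"
  have inv: "inverse (fps_cos 1) = inverse (B 0) oo fps_X\<^sup>2"
    by (simp add: fps_cos_bessel B_def fps_inverse_compose)
  have "fps_tan 1 = fps_sin 1 * inverse (fps_cos (1::real))"
    by (simp add: fps_tan_def fps_divide_unit)
  also have "\<dots> = fps_X * ((B 1 * inverse (B 0)) oo fps_X\<^sup>2)"
    unfolding inv by (simp add: fps_sin_bessel B_def fps_compose_X2_mult mult.assoc)
  finally have "tan_fps = B 1 * inverse (B 0)"
    by (intro fps_ext) (simp add: tan_fps_def euler_coeff_eq inv fps_nth_compose_X2)
  moreover have "inverse (B 0) * B 0 = 1"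
    by (rule inverse_mult_eq_1) (simp add: B_def)
  ultimately have "tan_fps * B 0 = B 1"
    by (metis mult.assoc mult_1_right)
  then show ?thesis
    by (simp only: B_def)
qed

text \<open>Lambert's fraction tan x = x / (1 - x^2 / (3 - x^2 / (5 - ...))), normalised and with
  \<open>X\<close> for x^2. Both columns come from the one formula
  \<open>1 / ((2 * n + 1) * (2 * n + 3))\<close>.\<close>

lemma tan_fps_sfrac:
  "has_sfrac tan_fps 1 (interleave (\<lambda>k. 1 / ((4 * real k + 1) * (4 * real k + 3)))
                                   (\<lambda>k. 1 / ((4 * real k + 3) * (4 * real k + 5))))"
proof -
  have "interleave (\<lambda>k. 1 / ((4 * real k + 1) * (4 * real k + 3)))
           (\<lambda>k. 1 / ((4 * real k + 3) * (4 * real k + 5))) n =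
         4 * (1 / 4) / ((2 * real n + 1) * (2 * real n + 3))" for n
    by (cases "even n") (auto simp: interleave_def algebra_simps elim!: oddE)
  then show ?thesis
    unfolding has_sfrac_def
    by (intro exI[of _ "bessel_fps (1 / 4)"] conjI allI)
       (simp_all only: tan_fps_mult bessel_fps_rec[symmetric] bessel_fps_nth_0 One_nat_def
          fps_const_1_eq_1 mult_1_left)
qed

section \<open>The series of all Euler numbers\<close>

definition euler_fps :: "real fps" where
  "euler_fps = Abs_fps euler_coeff"

text \<open>With \<open>C\<close> and \<open>S\<close> at half the argument, cos x is
  \<open>(C + S) * (C - S)\<close> and 1 + sin x is the square of \<open>C + S\<close>, so the
  factor \<open>C + S\<close> cancels. Numerator and denominator become linear in Bessel-type
  series.\<close>

lemma euler_fps_mult: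
  "euler_fps * (fps_cos (1 / 2) - fps_sin (1 / 2)) = fps_cos (1 / 2) + fps_sin (1 / 2)"
proof -
  define C S :: "real fps" where "C = fps_cos (1 / 2)" and "S = fps_sin (1 / 2)"
  have one: "C\<^sup>2 + S\<^sup>2 = 1"
    unfolding C_def S_def by (rule fps_sin_cos_sum_of_squares)
  have "fps_cos 1 = (C + S) * (C - S)"
    using fps_cos_add[of "1/2::real" "1/2"] by (simp add: C_def S_def algebra_simps)
  moreover have "fps_sin 1 = 2 * S * C"
    using fps_sin_add[of "1/2::real" "1/2"] by (simp add: C_def S_def algebra_simps)
  moreover have "euler_fps = (fps_sin 1 + 1) * inverse (fps_cos 1)"
    by (rule fps_ext) (simp add: euler_fps_def euler_coeff_eq fps_tan_def fps_divide_unit algebra_simps)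
  moreover have "inverse (fps_cos 1) * fps_cos (1::real) = 1"
    by (rule inverse_mult_eq_1) simp
  ultimately have "euler_fps * ((C + S) * (C - S)) = 2 * S * C + 1"
    by (metis mult.assoc mult_1_right)
  then have "euler_fps * (C - S) * (C + S) = (C + S) * (C + S)"
    by (simp add: algebra_simps power2_eq_square flip: one)
  moreover have "fps_nth (C + S) 0 \<noteq> fps_nth 0 0"
    by (simp add: C_def S_def)
  then have "C + S \<noteq> 0" by metis
  ultimately show ?thesis
    by (simp add: C_def S_def)
qed

text \<open>A Bessel step carries the square of \<open>X\<close>, a Stieltjes step only
  \<open>X\<close>. The Bessel coefficient factors as \<open>s n * s (Suc n)\<close>, so each Bessel
  step splits into two; the sign of this product forces the alternating signs in
  \<open>s\<close>.\<close>

lemma euler_fps_sfrac: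
  defines "s \<equiv> \<lambda>k. (-1) ^ k / (2 * (2 * real k + 1))"
  shows "has_sfrac euler_fps 1 (interleave (\<lambda>k. if k = 0 then 1 else s k) (\<lambda>k. - s k))"
proof -
  \<comment> \<open>The parameter is \<open>c^2 / 4\<close> for the half argument
    \<open>c = 1/2\<close>.\<close>
  define B where "B = (\<lambda>n. bessel_fps (1 / 16) n oo fps_X\<^sup>2)"
  have B0: "fps_nth (B n) 0 = 1" for n
    by (simp add: B_def)
  have s0: "s 0 = 1 / 2"
    by (simp add: s_def)
  have s_prod: "s n * s (Suc n) = - (1 / 4) / ((2 * real n + 1) * (2 * real n + 3))" for n
    by (simp add: s_def field_simps flip: power_add)
  have B_rec: "B n = B (Suc n) + fps_const (s n * s (Suc n)) * fps_X\<^sup>2 * B (Suc (Suc n))" for n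
    unfolding B_def
    by (subst bessel_fps_rec) (simp add: s_prod fps_compose_sub_distrib fps_compose_X2_mult flip: fps_const_neg)
  have cos: "fps_cos (1 / 2) = B 0" and sin: "fps_sin (1 / 2) = fps_const (1 / 2) * fps_X * B (Suc 0)"
    by (simp_all add: B_def fps_cos_bessel fps_sin_bessel power2_eq_square)
  define w where "w = (\<lambda>n. if n = 0 then B 0 - fps_const (1 / 2) * fps_X * B (Suc 0)
     else if even n then B (n div 2) else B (n div 2) + fps_const (s (n div 2)) * fps_X * B (Suc (n div 2)))"
  have w0: "w 0 = B 0 - fps_const (1 / 2) * fps_X * B (Suc 0)"
    and w_odd: "w (Suc (2 * n)) = B n + fps_const (s n) * fps_X * B (Suc n)"
    and w_even: "w (Suc (Suc (2 * n))) = B (Suc n)" for n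
    by (simp_all add: w_def)
  show ?thesis
    unfolding has_sfrac_def
  proof (intro exI[of _ w] conjI allI)
    show "fps_nth (w n) 0 = 1" for n
      by (simp add: w_def B0 mult.assoc)
    show "euler_fps * w 0 = fps_const 1 * w (Suc 0)"
      using euler_fps_mult w_odd[of 0] by (simp add: w0 cos sin s0)
    fix n
    let ?a = "interleave (\<lambda>k. if k = 0 then 1 else s k) (\<lambda>k. - s k)"
    consider "n = 0" | m where "n = Suc (2 * m)" | m where "n = Suc (Suc (2 * m))"
    proof (cases "even n")
      case True
      then obtain k where "n = 2 * k" by blast
      with that show thesis by (cases k) auto
    next
      case False
      with that show thesis by (auto elim: oddE)
    qed
    then show "w n = w (Suc n) - fps_const (?a n) * fps_X * w (Suc (Suc n))"
    proof cases
      case 1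
      \<comment> \<open>\<open>w 0\<close> is cosine minus sine and \<open>w 1\<close> is cosine
        plus sine, so they differ by twice the sine. Hence the first coefficient is 1, not
        \<open>s 0\<close>.\<close>
      have "(1::real fps) = fps_const (1 / 2) + fps_const (1 / 2)"
        by simp
      then have "fps_X * B (Suc 0) = fps_const (1 / 2) * (fps_X * B (Suc 0)) + fps_const (1 / 2) * (fps_X * B (Suc 0))"
        by (metis distrib_right mult_1)
      then show ?thesis
        using w_odd[of 0] w_even[of 0] by (simp add: 1 w0 s0 algebra_simps)
    next
      case (2 m)
      have w3: "w (Suc (Suc (Suc (2 * m)))) = B (Suc m) + fps_const (s (Suc m)) * fps_X * B (Suc (Suc m))"
        using w_odd[of "Suc m"] by simp
      show ?thesis
        unfolding 2 w_odd w_even w3 interleave_simps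
        by (subst B_rec[of m]) (simp add: algebra_simps power2_eq_square flip: fps_const_mult fps_const_neg)
    next
      case (3 m)
      show ?thesis
        unfolding 3 w_even using w_odd[of "Suc m"] w_even[of "Suc m"] by simp
    qed
  qed
qed

text \<open>The coefficients of the shifted fractions are quotients of consecutive ratios \<open>g\<close> of
  the claimed determinants; it remains to check the rhombus rules for them.\<close>

lemma tan_fps_sfrac_1:
  "has_sfrac (fps_shift 1 tan_fps) (1 / 3)
     (interleave (\<lambda>k. (real k + 2) * (2 * real k + 3) /
                      ((real k + 1) * (2 * real k + 1) * (4 * real k + 3) * (4 * real k + 5)))
                 (\<lambda>k. (real k + 1) * (2 * real k + 1) /
                      ((real k + 2) * (2 * real k + 3) * (4 * real k + 5) * (4 * real k + 7))))"
proof (rule has_sfrac_shift_qd[OF tan_fps_sfrac], goal_cases)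
  case 1
  show ?case by simp
next
  case (2 n)
  define x where "x = real n"
  have x: "real (Suc n) = x + 1" "x + 1 > 0" "x + 2 > 0" "2 * x + 1 > 0" "2 * x + 3 > 0"
    "4 * x + 3 > 0" "4 * x + 5 > 0" "4 * x + 7 > 0" "4 * x + 9 > 0" by (simp_all add: x_def)
  show ?case
    unfolding x(1) x_def[symmetric]
    using x by (simp add: divide_simps) (simp add: algebra_simps)
next
  case (3 n)
  define x where "x = real n"
  have x: "real (Suc n) = x + 1" "x + 1 > 0" "x + 2 > 0" "2 * x + 1 > 0" "2 * x + 3 > 0"
    "4 * x + 3 > 0" "4 * x + 5 > 0" "4 * x + 7 > 0" "4 * x + 9 > 0" by (simp_all add: x_def)
  show ?case
    unfolding x(1) x_def[symmetric]
    using x by (simp add: divide_simps) (simp add: algebra_simps)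
next
  case 4
  show ?case by simp
qed

text \<open>The quadratic \<open>4 * k^2 + 10 * k + 3\<close> is the irreducible factor in the
  determinants of the next shift; \<open>4 * k^2 + 18 * k + 17\<close> is its value at
  \<open>k + 1\<close>.\<close>

lemma tan_fps_sfrac_2:
  "has_sfrac (fps_shift 1 (fps_shift 1 tan_fps)) (2 / 15)
     (interleave (\<lambda>k. (4 * (real k)\<^sup>2 + 18 * real k + 17) * (real k + 3) * (2 * real k + 5) /
          ((4 * (real k)\<^sup>2 + 10 * real k + 3) * (real k + 2) * (2 * real k + 3) * (4 * real k + 5) * (4 * real k + 7)))
        (\<lambda>k. (4 * (real k)\<^sup>2 + 10 * real k + 3) * (real k + 1) * (2 * real k + 1) /
          ((4 * (real k)\<^sup>2 + 18 * real k + 17) * (real k + 2) * (2 * real k + 3) * (4 * real k + 7) * (4 * real k + 9))))"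
proof (rule has_sfrac_shift_qd[OF tan_fps_sfrac_1], goal_cases)
  case 1
  show ?case by simp
next
  case (2 n)
  \<comment> \<open>The coefficients \<open>e' n\<close> and \<open>q' (Suc n)\<close> share the
    denominator factor \<open>p\<close>. Writing the other quadratics as \<open>p\<close> plus a
    linear term lets the fractions be cleared with \<open>p\<close> as an atom, expanded only at the
    end.\<close>
  define x p where "x = real n" and "p = 4 * x\<^sup>2 + 18 * x + 17"
  have p: "4 * (x + 1)\<^sup>2 + 10 * (x + 1) + 3 = p" "4 * (x + 1)\<^sup>2 + 18 * (x + 1) + 17 = p + 8 * x + 22"
    "4 * x\<^sup>2 + 10 * x + 3 = p - 8 * x - 14" "4 * x\<^sup>2 + 18 * x + 17 = p"
    by (simp_all add: p_def power2_eq_square algebra_simps)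
  have x: "real (Suc n) = x + 1" "x + 1 > 0" "x + 2 > 0" "x + 3 > 0" "2 * x + 1 > 0" "2 * x + 3 > 0"
    "2 * x + 5 > 0" "4 * x + 5 > 0" "4 * x + 7 > 0" "4 * x + 9 > 0" "4 * x + 11 > 0" "p > 0"
    by (auto simp: x_def p_def intro!: add_nonneg_pos)
  show ?case
    unfolding x(1) x_def[symmetric] p
    using x(2-) by (simp add: divide_simps) (simp add: algebra_simps p_def power2_eq_square)
next
  case (3 n)
  define x p r where "x = real n" and "p = 4 * x\<^sup>2 + 18 * x + 17" and "r = 4 * x\<^sup>2 + 10 * x + 3"
  have x: "real (Suc n) = x + 1" "x + 1 > 0" "x + 2 > 0" "x + 3 > 0" "2 * x + 1 > 0" "2 * x + 3 > 0"
    "2 * x + 5 > 0" "4 * x + 5 > 0" "4 * x + 7 > 0" "4 * x + 9 > 0" "4 * x + 11 > 0" "p > 0" "r > 0"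
    by (auto simp: x_def p_def r_def intro!: add_nonneg_pos)
  show ?case
    unfolding x(1) x_def[symmetric] p_def[symmetric] r_def[symmetric]
    using x(2-) by (simp add: divide_simps) (simp add: algebra_simps)
next
  case 4
  show ?case by simp
qed

lemma euler_fps_sfrac_1:
  "has_sfrac (fps_shift 1 euler_fps) 1
     (interleave (\<lambda>k. (-1) ^ k / (2 * (2 * real k + 1))) (\<lambda>k. (-1) ^ k / (2 * (2 * real k + 3))))"
proof (rule has_sfrac_shift_qd[OF euler_fps_sfrac], goal_cases)
  case (2 n)
  show ?case by (simp add: add.commute)
next
  case (3 n)
  show ?case by (simp add: field_simps)
qed simp_all

lemma euler_fps_sfrac_2:
  "has_sfrac (fps_shift 1 (fps_shift 1 euler_fps)) (1 / 2)
     (interleave (\<lambda>k. (-1) ^ k * (real k + 2)\<^sup>2 / (2 * (real k + 1)\<^sup>2 * (2 * real k + 3)))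
                 (\<lambda>k. - ((-1) ^ k) * (real k + 1)\<^sup>2 / (2 * (real k + 2)\<^sup>2 * (2 * real k + 3))))"
proof (rule has_sfrac_shift_qd[OF euler_fps_sfrac_1], goal_cases)
  case (2 n)
  define x where "x = real n"
  have x: "real (Suc n) = x + 1" "x + 1 > 0" "x + 2 > 0" "x + 3 > 0" "2 * x + 3 > 0" "2 * x + 5 > 0"
    by (simp_all add: x_def)
  show ?case
    unfolding x(1) x_def[symmetric] power2_eq_square
    \<comment> \<open>Fixing the parity of \<open>n\<close> removes the powers of -1.\<close>
    using x(2-) by (cases "even n"; simp add: divide_simps) (simp_all add: algebra_simps)
next
  case (3 n)
  define x where "x = real n"
  have x: "real (Suc n) = x + 1" "x + 1 > 0" "x + 2 > 0" "2 * x + 3 > 0"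
    by (simp_all add: x_def)
  show ?case
    unfolding x(1) x_def[symmetric] power2_eq_square
    using x(2-) by (cases "even n"; simp add: divide_simps)
qed simp_all

text \<open>Here too the quadratic \<open>k^2 + 3 * k + 1\<close> stems from the determinants of the
  next shift, and \<open>k^2 + 5 * k + 5\<close> is its value at \<open>k + 1\<close>.\<close>

lemma euler_fps_sfrac_3:
  "has_sfrac (fps_shift 1 (fps_shift 1 (fps_shift 1 euler_fps))) (1 / 3)
     (interleave (\<lambda>k. (-1) ^ k * (real k + 1) * (real k + 3) * ((real k)\<^sup>2 + 5 * real k + 5) /
                    (2 * (real k + 2)\<^sup>2 * (2 * real k + 3) * ((real k)\<^sup>2 + 3 * real k + 1)))
                 (\<lambda>k. (-1) ^ k * (real k + 1) * (real k + 3) * ((real k)\<^sup>2 + 3 * real k + 1) /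
                    (2 * (real k + 2)\<^sup>2 * (2 * real k + 5) * ((real k)\<^sup>2 + 5 * real k + 5))))"
proof (rule has_sfrac_shift_qd[OF euler_fps_sfrac_2], goal_cases)
  case (2 n)
  define x p where "x = real n" and "p = x * x + 5 * x + 5"
  have p: "(x + 1) * (x + 1) + 3 * (x + 1) + 1 = p" "(x + 1) * (x + 1) + 5 * (x + 1) + 5 = p + 2 * x + 6"
    "x * x + 3 * x + 1 = p - 2 * x - 4" "x * x + 5 * x + 5 = p"
    by (simp_all add: p_def algebra_simps)
  have x: "real (Suc n) = x + 1" "x + 1 > 0" "x + 2 > 0" "x + 3 > 0" "2 * x + 3 > 0" "2 * x + 5 > 0" "p > 0"
    by (auto simp: x_def p_def intro!: add_nonneg_pos)
  show ?case
    unfolding x(1) x_def[symmetric] power2_eq_square p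
    using x(2-) by (cases "even n"; simp add: divide_simps) (simp_all add: algebra_simps p_def)
next
  case (3 n)
  define x p r where "x = real n" and "p = x * x + 5 * x + 5" and "r = x * x + 3 * x + 1"
  have x: "real (Suc n) = x + 1" "x + 1 > 0" "x + 2 > 0" "x + 3 > 0" "2 * x + 3 > 0" "2 * x + 5 > 0" "p > 0" "r > 0"
    by (auto simp: x_def p_def r_def intro!: add_nonneg_pos)
  show ?case
    unfolding x(1) x_def[symmetric] power2_eq_square p_def[symmetric] r_def[symmetric]
    using x(2-) by (cases "even n"; simp add: divide_simps) (simp_all add: algebra_simps)
qed simp_all

section \<open>Closed forms\<close>

definition fact_ratio :: "nat \<Rightarrow> real" where
  "fact_ratio k = fact k / fact (2 * k + 1)"

lemma fact_ratio_0 [simp]: "fact_ratio 0 = 1"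
  by (simp add: fact_ratio_def)

text \<open>As a rewrite rule it turns identities between factorials into identities between
  rational functions.\<close>

lemma fact_ratio_Suc [simp]: "fact_ratio (Suc k) = fact_ratio k / (2 * (2 * real k + 3))"
proof -
  define a b x where "a = (fact k :: real)" and "b = (fact (2 * k + 1) :: real)" and "x = real k"
  have "fact (2 * Suc k + 1) = (2 * x + 3) * ((2 * x + 2) * b)"
    by (simp add: b_def x_def algebra_simps)
  moreover have "fact (Suc k) = (x + 1) * a"
    by (simp add: a_def x_def algebra_simps)
  moreover have "b > 0" "x + 1 > 0" "2 * x + 3 > 0"
    by (simp_all add: b_def x_def)
  ultimately show ?thesis
    unfolding fact_ratio_def a_def[symmetric] b_def[symmetric] x_def[symmetric]
    by (simp add: divide_simps del: fact_Suc) (simp add: algebra_simps)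
qed

text \<open>The range includes 0, where the factor is 1, so the recursion needs no exceptional first
  step.\<close>

definition fact_ratio_prod :: "nat \<Rightarrow> real" where
  "fact_ratio_prod m = (\<Prod>k<m. fact_ratio k)"

lemma fact_ratio_prod_simps [simp]:
  "fact_ratio_prod 0 = 1"
  "fact_ratio_prod (Suc m) = fact_ratio_prod m * fact_ratio m"
  by (simp_all add: fact_ratio_prod_def)

lemma prod_fact_ratio: "(\<Prod>k=1..m. fact_ratio k) = fact_ratio_prod (Suc m)"
  by (induction m) simp_all

abbreviation (input) euler_sign :: "nat \<Rightarrow> real" where
  "euler_sign n \<equiv> (-1) ^ (n * (n - 1) div 2)"

lemma euler_sign_Suc: "euler_sign (Suc n) = euler_sign n * (-1) ^ n"
proof -
  have "Suc n * (Suc n - 1) = n * (n - 1) + 2 * n"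
    by (cases n) simp_all
  then have "Suc n * (Suc n - 1) div 2 = n * (n - 1) div 2 + n"
    by simp
  then show ?thesis
    by (simp add: power_add)
qed

section \<open>Determinants of the tangent families\<close>

lemma hankel_det_tan:
  "hankel_det (fps_nth tan_fps) (Suc n) = 2 ^ (n * (2 * n + 1)) * fact_ratio_prod (2 * n + 1)"
proof -
  define K :: "nat \<Rightarrow> real" where
    "K = (\<lambda>n. case n of 0 \<Rightarrow> 1 | Suc m \<Rightarrow> 2 ^ (m * (2 * m + 1)) * fact_ratio_prod (2 * m + 1))"
  have "hankel_det (fps_nth tan_fps) (Suc n) = K (Suc n)"
  \<comment> \<open>The quotient of the claimed determinants contains
    \<open>fact_ratio (2 * n - 1)\<close>; replacing it by
    \<open>2 * (4 * n + 1) * fact_ratio (2 * n)\<close> gives a form that is also right at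
    \<open>n = 0\<close>.\<close>
  proof (rule hankel_det_sfrac[OF tan_fps_sfrac, where g = "\<lambda>n. 2 ^ (4 * n) * (4 * real n + 1) * (fact_ratio (2 * n))\<^sup>2"],
      goal_cases)
    case (2 n)
    define x c where "x = real n" and "c = fact_ratio (2 * n)"
    have "x \<ge> 0" by (simp add: x_def)
    then have "4 * x + 1 > 0" "4 * x + 3 > 0" "4 * x + 5 > 0" by simp_all
    then show ?case
      by (simp add: power2_eq_square power_add flip: x_def c_def) (simp add: divide_simps, simp add: algebra_simps)
  next
    case (4 n)
    show ?case
    proof (cases n)
      case (Suc m)
      have "Suc m * (2 * Suc m + 1) = m * (2 * m + 1) + (4 * m + 3)"
        by (simp add: algebra_simps)
      then have "2 ^ (Suc m * (2 * Suc m + 1)) = 2 ^ (m * (2 * m + 1)) * 2 ^ (4 * m) * (8 :: real)"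
        by (simp only: power_add) simp
      then show ?thesis
        by (simp add: K_def Suc divide_simps power_add power2_eq_square del: mult_Suc)
    qed (simp add: K_def)
  qed (simp_all add: K_def)
  then show ?thesis by (simp add: K_def)
qed

lemma hankel_det_tan_1:
  "hankel_det (fps_nth (fps_shift 1 tan_fps)) n = 2 ^ (n * (2 * n - 1)) * fact_ratio_prod (2 * n)"
proof (rule hankel_det_sfrac_shift[OF tan_fps_sfrac,
    where g = "\<lambda>n. 2 ^ (4 * n + 1) * fact_ratio (2 * n) * fact_ratio (2 * n + 1)"], goal_cases)
  case (2 n)
  define x c where "x = real n" and "c = fact_ratio (2 * n)"
  have "x \<ge> 0" by (simp add: x_def)
  then have "4 * x + 3 > 0" "4 * x + 5 > 0" "4 * x + 7 > 0" by simp_all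
  then show ?case
    by (simp add: power2_eq_square power_add flip: x_def c_def) (simp add: divide_simps, simp add: algebra_simps)
next
  case (4 n)
  have "Suc n * (2 * Suc n - 1) = n * (2 * n - 1) + (4 * n + 1)"
    by (cases n) (simp_all add: algebra_simps)
  then have "2 ^ (Suc n * (2 * Suc n - 1)) = 2 ^ (n * (2 * n - 1)) * 2 ^ (4 * n) * (2 :: real)"
    by (simp only: power_add) simp
  then show ?case
    by (simp add: power_add del: mult_Suc)
qed simp_all


lemma hankel_det_tan_2:
  "hankel_det (fps_nth (fps_shift 1 (fps_shift 1 tan_fps))) n =
     2 ^ (n * (2 * n + 1)) * (real n + 1) * (2 * real n + 1) * fact_ratio_prod (2 * n + 1)"
proof (rule hankel_det_sfrac_shift[OF tan_fps_sfrac_1,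
    where g = "\<lambda>n. 2 ^ (4 * n + 3) * ((real n + 2) * (2 * real n + 3) / ((real n + 1) * (2 * real n + 1))) *
      fact_ratio (2 * n + 1) * fact_ratio (2 * n + 2)"], goal_cases)
  case (2 n)
  define x c where "x = real n" and "c = fact_ratio (2 * n)"
  have "real (Suc n) = x + 1" "x + 1 > 0" "x + 2 > 0" "x + 3 > 0" "2 * x + 1 > 0" "2 * x + 3 > 0" "2 * x + 5 > 0"
    "4 * x + 3 > 0" "4 * x + 5 > 0" "4 * x + 7 > 0" "4 * x + 9 > 0"
    by (simp_all add: x_def)
  then show ?case
    by (simp add: power2_eq_square power_add flip: x_def c_def) (simp add: divide_simps, simp add: algebra_simps)
next
  case (4 n)
  have "Suc n * (2 * Suc n + 1) = n * (2 * n + 1) + (4 * n + 3)"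
    by (simp add: algebra_simps)
  then have pow: "2 ^ (Suc n * (2 * Suc n + 1)) = 2 ^ (n * (2 * n + 1)) * 2 ^ (4 * n) * (8 :: real)"
    by (simp only: power_add) simp
  define x where "x = real n"
  have "real (Suc n) = x + 1" "x + 1 > 0" "2 * x + 1 > 0" "4 * x + 3 > 0" "4 * x + 5 > 0"
    by (simp_all add: x_def)
  then show ?case
    unfolding pow
    by (simp add: power_add del: mult_Suc of_nat_Suc flip: x_def) (simp add: divide_simps, simp add: algebra_simps)
qed simp_all

lemma hankel_det_tan_3:
  "hankel_det (fps_nth (fps_shift 1 (fps_shift 1 (fps_shift 1 tan_fps)))) n =
     2 ^ (n * (2 * n + 3)) * (2 * real n + 1) * (4 * (real n)\<^sup>2 + 10 * real n + 3) *
     ((real n + 1) * (real n + 2) * (2 * real n + 3) / 3) * fact_ratio_prod (2 * n + 2)"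
proof (rule hankel_det_sfrac_shift[OF tan_fps_sfrac_2,
    where g = "\<lambda>n. 2 ^ (4 * n) * 32 * ((4 * (real n)\<^sup>2 + 18 * real n + 17) * (real n + 3) * (2 * real n + 5) /
        ((4 * (real n)\<^sup>2 + 10 * real n + 3) * (real n + 1) * (2 * real n + 1))) *
      fact_ratio (Suc (Suc (2 * n))) * fact_ratio (Suc (Suc (Suc (2 * n))))"], goal_cases)
  case (2 n)
  define x c p r s where "x = real n" and "c = fact_ratio (2 * n)" and "p = 4 * x\<^sup>2 + 18 * x + 17"
    and "r = 4 * x\<^sup>2 + 10 * x + 3" and "s = 4 * (x + 1)\<^sup>2 + 18 * (x + 1) + 17"
  have x: "real (Suc n) = x + 1" "4 * (x + 1)\<^sup>2 + 10 * (x + 1) + 3 = p"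
    by (simp_all add: x_def p_def power2_eq_square algebra_simps)
  have "x + 1 > 0" "x + 2 > 0" "x + 3 > 0" "2 * x + 1 > 0" "2 * x + 3 > 0" "2 * x + 5 > 0"
    "4 * x + 3 > 0" "4 * x + 5 > 0" "4 * x + 7 > 0" "4 * x + 9 > 0" "4 * x + 11 > 0"
    "p > 0" "r > 0"
    by (auto simp: x_def p_def r_def intro!: add_nonneg_pos)
  moreover have "s > 0"
    unfolding s_def by (intro add_nonneg_pos add_nonneg_nonneg) (simp_all add: x_def)
  ultimately have pos: "x + 1 > 0" "x + 2 > 0" "x + 3 > 0" "2 * x + 1 > 0" "2 * x + 3 > 0" "2 * x + 5 > 0"
    "4 * x + 3 > 0" "4 * x + 5 > 0" "4 * x + 7 > 0" "4 * x + 9 > 0" "4 * x + 11 > 0"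
    "p > 0" "r > 0" "s > 0"
    by simp_all
  show ?case
    unfolding x x_def[symmetric] p_def[symmetric] r_def[symmetric] s_def[symmetric]
    using pos by (simp add: power_add flip: x_def c_def) (simp add: divide_simps, simp add: algebra_simps)
next
  case (4 n)
  have "Suc n * (2 * Suc n + 3) = n * (2 * n + 3) + (4 * n + 5)"
    by (simp add: algebra_simps)
  then have pow: "2 ^ (Suc n * (2 * Suc n + 3)) = 2 ^ (n * (2 * n + 3)) * 2 ^ (4 * n) * (32 :: real)"
    by (simp only: power_add) simp
  define x p r where "x = real n" and "p = 4 * x\<^sup>2 + 18 * x + 17" and "r = 4 * x\<^sup>2 + 10 * x + 3"
  have x: "real (Suc n) = x + 1" "4 * (x + 1)\<^sup>2 + 10 * (x + 1) + 3 = p"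
    by (simp_all add: x_def p_def power2_eq_square algebra_simps)
  have pos: "x + 1 > 0" "x + 2 > 0" "2 * x + 1 > 0" "2 * x + 3 > 0" "2 * x + 5 > 0" "p > 0" "r > 0"
    by (auto simp: x_def p_def r_def intro!: add_nonneg_pos)
  show ?case
    unfolding pow x x_def[symmetric] p_def[symmetric] r_def[symmetric]
    using pos by (simp add: power_add flip: x_def) (simp add: divide_simps, simp add: algebra_simps)
qed (simp_all add: eval_nat_numeral)

lemma hankel_det_tan_X2:
  "hankel_det (fps_nth (tan_fps oo fps_X\<^sup>2)) (Suc n) = 2 ^ n\<^sup>2 * fact_ratio n * (fact_ratio_prod n)\<^sup>2"
proof -
  define K :: "nat \<Rightarrow> real" where
    "K = (\<lambda>n. case n of 0 \<Rightarrow> 1 | Suc m \<Rightarrow> 2 ^ m\<^sup>2 * fact_ratio m * (fact_ratio_prod m)\<^sup>2)"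
  have "hankel_det (fps_nth (tan_fps oo fps_X\<^sup>2)) (Suc n) = K (Suc n)"
  proof (rule hankel_det_compose_X2[OF tan_fps_sfrac,
      where g = "\<lambda>n. 2 ^ (2 * n) * (2 * real n + 1) * (fact_ratio n)\<^sup>2"], goal_cases)
    case (2 n)
    define x c where "x = real n" and "c = fact_ratio n"
    \<comment> \<open>The two columns merge again, so a single formula covers both parities.\<close>
    have "interleave (\<lambda>k. 1 / ((4 * real k + 1) * (4 * real k + 3)))
             (\<lambda>k. 1 / ((4 * real k + 3) * (4 * real k + 5))) n = 1 / ((2 * x + 1) * (2 * x + 3))"
      by (cases "even n") (auto simp: interleave_def x_def algebra_simps elim!: oddE)
    moreover have "2 * x + 1 > 0" "2 * x + 3 > 0" by (simp_all add: x_def)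
    ultimately show ?case
      by (simp add: power2_eq_square flip: x_def c_def) (simp add: divide_simps, simp add: algebra_simps)
  next
    case (4 n)
    show ?case
    proof (cases n)
      case (Suc m)
      have "(Suc m)\<^sup>2 = m\<^sup>2 + (2 * m + 1)"
        by (simp add: power2_eq_square)
      then have "2 ^ (Suc m)\<^sup>2 = 2 ^ m\<^sup>2 * 2 ^ (2 * m) * (2 :: real)"
        by (simp only: power_add) simp
      then show ?thesis
        by (simp add: K_def Suc divide_simps) (simp add: power2_eq_square algebra_simps)
    qed (simp add: K_def)
  qed (simp_all add: K_def)
  then show ?thesis by (simp add: K_def)
qed

text \<open>Here the two columns do not merge, so the sizes are treated by parity. The power of 2 is
  written as a quotient because its exponent \<open>4 * n^2 - 1\<close> is negative at
  \<open>n = 0\<close>.\<close>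

lemma hankel_det_tan_1_X2:
  "hankel_det (fps_nth (fps_shift 1 tan_fps oo fps_X\<^sup>2)) (2 * n) =
     2 ^ (4 * n\<^sup>2) / 2 * ((2 * real n + 2) * (2 * real n + 1) * fact_ratio (2 * n)) * (fact_ratio_prod (2 * n))\<^sup>2"
  (is "_ = ?even n")
  "hankel_det (fps_nth (fps_shift 1 tan_fps oo fps_X\<^sup>2)) (2 * n + 1) =
     2 ^ (4 * n * (n + 1)) * ((2 * real n + 1) * (2 * real n + 2) * fact_ratio (2 * n + 1)) * (fact_ratio_prod (2 * n + 1))\<^sup>2"
  (is "_ = ?odd n")
proof -
  define g :: "nat \<Rightarrow> real" where
    "g = interleave (\<lambda>n. 2 ^ (4 * n) / (4 * real n + 3) * (fact_ratio (2 * n))\<^sup>2)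
       (\<lambda>n. 2 ^ (4 * n + 2) * ((2 * real n + 3) * (real n + 2) / ((2 * real n + 1) * (real n + 1) * (4 * real n + 5))) *
          (fact_ratio (2 * n + 1))\<^sup>2)"
  define K where "K = interleave ?even ?odd"
  have parity: "thesis" if "\<And>m. n = 2 * m \<Longrightarrow> thesis" "\<And>m. n = Suc (2 * m) \<Longrightarrow> thesis" for n thesis
    using that by (metis evenE oddE Suc_eq_plus1)
  have "hankel_det (fps_nth (fps_shift 1 tan_fps oo fps_X\<^sup>2)) n = K n" for n
  proof (rule hankel_det_compose_X2[OF tan_fps_sfrac_1, where g = g], goal_cases)
    case (2 n)
    show ?case
    proof (rule parity[of n])
      fix m assume m: "n = 2 * m"
      define x c where "x = real m" and "c = fact_ratio (2 * m)"
      have "real (Suc m) = x + 1" "x + 1 > 0" "x + 2 > 0" "2 * x + 1 > 0" "2 * x + 3 > 0"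
        "4 * x + 3 > 0" "4 * x + 5 > 0" by (simp_all add: x_def)
      then show ?case
        by (simp add: m g_def power_add power2_eq_square flip: x_def c_def)
           (simp add: divide_simps, simp add: algebra_simps)
    next
      fix m assume m: "n = Suc (2 * m)"
      define x c where "x = real m" and "c = fact_ratio (2 * m)"
      have "real (Suc m) = x + 1" "x + 1 > 0" "x + 2 > 0" "2 * x + 1 > 0" "2 * x + 3 > 0"
        "4 * x + 3 > 0" "4 * x + 5 > 0" "4 * x + 7 > 0" by (simp_all add: x_def)
      then show ?case
        by (simp add: m g_def power_add power2_eq_square flip: x_def c_def)
           (simp add: divide_simps, simp add: algebra_simps)
    qed
  next
    case (4 n)
    show ?case
    proof (rule parity[of n])
      fix m assume m: "n = 2 * m"
      have "4 * m * (m + 1) = 4 * m\<^sup>2 + 4 * m"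
        by (simp add: power2_eq_square)
      then have "2 ^ (4 * m * (m + 1)) = 2 ^ (4 * m\<^sup>2) * (2 ^ (4 * m) :: real)"
        by (simp only: power_add)
      moreover define x c where "x = real m" and "c = fact_ratio (2 * m)"
      have "x + 1 > 0" "4 * x + 3 > 0" by (simp_all add: x_def)
      ultimately show ?case
        by (simp add: m K_def g_def power_mult_distrib flip: x_def c_def)
    next
      fix m assume m: "n = Suc (2 * m)"
      have "4 * (Suc m)\<^sup>2 = 4 * m * (m + 1) + (4 * m + 4)"
        by (simp add: power2_eq_square)
      then have "2 ^ (4 * (Suc m)\<^sup>2) = 2 ^ (4 * m * (m + 1)) * 2 ^ (4 * m) * (16::real)"
        by (simp only: power_add) simp
      moreover define x c where "x = real m" and "c = fact_ratio (2 * m)"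
      have "real (Suc m) = x + 1" "x + 1 > 0" "x + 2 > 0" "2 * x + 1 > 0" "2 * x + 3 > 0"
        "4 * x + 3 > 0" "4 * x + 5 > 0" by (simp_all add: x_def)
      ultimately show ?case
        by (simp add: m K_def g_def power_mult_distrib power_add flip: x_def c_def)
           (simp add: divide_simps power2_eq_square, simp add: algebra_simps)
    qed
  qed (simp_all add: K_def g_def)
  from this[of "2 * n"] this[of "2 * n + 1"]
  show "hankel_det (fps_nth (fps_shift 1 tan_fps oo fps_X\<^sup>2)) (2 * n) = ?even n"
    "hankel_det (fps_nth (fps_shift 1 tan_fps oo fps_X\<^sup>2)) (2 * n + 1) = ?odd n"
    by (simp_all add: K_def)
qed

section \<open>Determinants of the families with all Euler numbers\<close>

lemma hankel_det_euler:
  "hankel_det (fps_nth euler_fps) (Suc n) = euler_sign (Suc n) / 2 ^ n * (fact_ratio_prod n)\<^sup>2"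
proof -
  define K :: "nat \<Rightarrow> real" where
    "K = (\<lambda>n. case n of 0 \<Rightarrow> 1 | Suc m \<Rightarrow> euler_sign (Suc m) / 2 ^ m * (fact_ratio_prod m)\<^sup>2)"
  have "hankel_det (fps_nth euler_fps) (Suc n) = K (Suc n)"
  proof (rule hankel_det_sfrac[OF euler_fps_sfrac,
      \<comment> \<open>The general formula would give 2 at \<open>n = 0\<close>; the exception
        mirrors the first coefficient 1 in place of 1/2.\<close>
      where g = "\<lambda>n. if n = 0 then 1 else (-1) ^ n * 2 * ((2 * real n + 1) * fact_ratio n)\<^sup>2"], goal_cases)
    case (2 n)
    define x c where "x = real n" and "c = fact_ratio n"
    have pos: "2 * x + 1 > 0" "2 * x + 3 > 0" by (simp_all add: x_def)
    show ?case
    proof (cases "n = 0")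
      case False
      then show ?thesis
        using pos by (cases "even n"; simp add: power2_eq_square flip: x_def c_def)
          (simp_all add: divide_simps, simp_all add: algebra_simps)
    qed (simp add: power2_eq_square)
  next
    case (4 n)
    show ?case
    proof (cases n)
      case (Suc m)
      define x c where "x = real m" and "c = fact_ratio m"
      have "2 * x + 3 > 0" by (simp add: x_def)
      then show ?thesis
        unfolding Suc K_def nat.case euler_sign_Suc[of "Suc m"]
        by (simp add: power2_eq_square flip: x_def c_def) (simp add: divide_simps, simp add: algebra_simps)
    qed (simp add: K_def)
  qed (simp_all add: K_def)
  then show ?thesis by (simp add: K_def)
qed

lemma hankel_det_euler_1:
  "hankel_det (fps_nth (fps_shift 1 euler_fps)) (Suc n) = fact_ratio n / 2 ^ n * (fact_ratio_prod n)\<^sup>2"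
proof -
  define K :: "nat \<Rightarrow> real" where
    "K = (\<lambda>n. case n of 0 \<Rightarrow> 1 | Suc m \<Rightarrow> fact_ratio m / 2 ^ m * (fact_ratio_prod m)\<^sup>2)"
  have "hankel_det (fps_nth (fps_shift 1 euler_fps)) (Suc n) = K (Suc n)"
  proof (rule hankel_det_sfrac[OF euler_fps_sfrac_1,
      where g = "\<lambda>n. (2 * real n + 1) * (fact_ratio n)\<^sup>2"], goal_cases)
    case (2 n)
    define x c where "x = real n" and "c = fact_ratio n"
    have "2 * x + 1 > 0" "2 * x + 3 > 0" by (simp_all add: x_def)
    then show ?case
      by (cases "even n"; simp add: power2_eq_square flip: x_def c_def)
         (simp_all add: divide_simps, simp_all add: algebra_simps)
  next
    case (4 n)
    show ?case
    proof (cases n)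
      case (Suc m)
      define x c where "x = real m" and "c = fact_ratio m"
      have "2 * x + 3 > 0" by (simp add: x_def)
      then show ?thesis
        unfolding Suc K_def nat.case
        by (simp add: power2_eq_square flip: x_def c_def) (simp add: divide_simps, simp add: algebra_simps)
    qed (simp add: K_def)
  qed (simp_all add: K_def)
  then show ?thesis by (simp add: K_def)
qed

lemma hankel_det_euler_2:
  "hankel_det (fps_nth (fps_shift 1 (fps_shift 1 euler_fps))) n =
     euler_sign n / 2 ^ n * (fact_ratio_prod n)\<^sup>2"
proof (rule hankel_det_sfrac_shift[OF euler_fps_sfrac_1,
    where g = "\<lambda>n. (-1) ^ n / 2 * (fact_ratio n)\<^sup>2"], goal_cases)
  case (2 n)
  define x c where "x = real n" and "c = fact_ratio n"
  have "2 * x + 3 > 0" by (simp add: x_def)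
  then show ?case
    by (cases "even n"; simp add: power2_eq_square flip: x_def c_def)
next
  case (4 n)
  show ?case
    unfolding euler_sign_Suc by (simp add: power_mult_distrib mult_ac)
qed simp_all

lemma hankel_det_euler_3:
  "hankel_det (fps_nth (fps_shift 1 (fps_shift 1 (fps_shift 1 euler_fps)))) n =
     (real n + 1)\<^sup>2 * fact_ratio n / 2 ^ n * (fact_ratio_prod n)\<^sup>2"
proof (rule hankel_det_sfrac[OF euler_fps_sfrac_3,
    where g = "\<lambda>n. (real n + 2)\<^sup>2 / (4 * (real n + 1)\<^sup>2 * (2 * real n + 3)) * (fact_ratio n)\<^sup>2"], goal_cases)
  case (2 n)
  define x c p r where "x = real n" and "c = fact_ratio n"
    and "p = x * x + 5 * x + 5" and "r = x * x + 3 * x + 1"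
  have x: "real (Suc n) = x + 1" by (simp add: x_def)
  have pos: "x + 1 > 0" "x + 2 > 0" "2 * x + 3 > 0" "2 * x + 5 > 0" "p > 0" "r > 0"
    by (auto simp: x_def p_def r_def intro!: add_nonneg_pos)
  show ?case
    unfolding x x_def[symmetric] power2_eq_square p_def[symmetric] r_def[symmetric]
    using pos by (cases "even n"; simp flip: x_def c_def) (simp_all add: divide_simps, simp_all add: algebra_simps)
next
  case (4 n)
  define x c where "x = real n" and "c = fact_ratio n"
  have x: "real (Suc n) = x + 1" by (simp add: x_def)
  have pos: "x + 1 > 0" "x + 2 > 0" "2 * x + 3 > 0" by (simp_all add: x_def)
  show ?case
    unfolding x x_def[symmetric] power2_eq_square
    using pos by (simp flip: x_def c_def) (simp add: divide_simps, simp add: algebra_simps)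
qed simp_all

lemma hankel_det_euler_4:
  "hankel_det (fps_nth (fps_shift 1 (fps_shift 1 (fps_shift 1 (fps_shift 1 euler_fps))))) n =
     euler_sign n * ((real n + 1) * (real n + 2) * ((real n)\<^sup>2 + 3 * real n + 1) / 2 ^ (n + 1)) *
     (fact_ratio_prod (Suc n))\<^sup>2"
proof (rule hankel_det_sfrac_shift[OF euler_fps_sfrac_3,
    where g = "\<lambda>n. (-1) ^ n * ((real n + 3) * ((real n)\<^sup>2 + 5 * real n + 5) /
      (2 * (real n + 1) * ((real n)\<^sup>2 + 3 * real n + 1))) * (fact_ratio (Suc n))\<^sup>2"], goal_cases)
  case (2 n)
  define x c p r s where "x = real n" and "c = fact_ratio n"
    and "p = x * x + 5 * x + 5" and "r = x * x + 3 * x + 1" and "s = (x + 1) * (x + 1) + 5 * (x + 1) + 5"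
  have x: "real (Suc n) = x + 1" "(x + 1) * (x + 1) + 3 * (x + 1) + 1 = p"
    by (simp_all add: x_def p_def algebra_simps)
  have pos: "x + 1 > 0" "x + 2 > 0" "x + 3 > 0" "2 * x + 3 > 0" "2 * x + 5 > 0" "p > 0" "r > 0" "s > 0"
    by (auto simp: x_def p_def r_def s_def intro!: add_nonneg_pos add_nonneg_nonneg simp del: distrib_left_numeral)
  show ?case
    unfolding x x_def[symmetric] power2_eq_square p_def[symmetric] r_def[symmetric] s_def[symmetric]
    using pos by (cases "even n"; simp flip: x_def c_def) (simp_all add: divide_simps, simp_all add: algebra_simps)
next
  case (4 n)
  define x c p r where "x = real n" and "c = fact_ratio n"
    and "p = x * x + 5 * x + 5" and "r = x * x + 3 * x + 1"
  have x: "real (Suc n) = x + 1" "(x + 1) * (x + 1) + 3 * (x + 1) + 1 = p"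
    by (simp_all add: x_def p_def algebra_simps)
  have pos: "x + 1 > 0" "x + 2 > 0" "x + 3 > 0" "2 * x + 3 > 0" "2 * x + 5 > 0" "p > 0" "r > 0"
    by (auto simp: x_def p_def r_def intro!: add_nonneg_pos)
  show ?case
    unfolding euler_sign_Suc x x_def[symmetric] power2_eq_square p_def[symmetric] r_def[symmetric]
    using pos by (simp flip: x_def c_def) (simp add: divide_simps, simp add: algebra_simps)
qed (simp_all add: power2_eq_square)

section \<open>Translation to the stated products and sequences\<close>

lemma prod_fact_ratio_atLeastAtMost:
  "(\<Prod>k=1..m. fact k / fact (2 * k + 1)) = fact_ratio_prod (Suc m)"
  using prod_fact_ratio[of m] by (simp add: fact_ratio_def)

text \<open>Truncated subtraction is harmless at \<open>m = 0\<close>: the range is empty and both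
  sides are 1.\<close>

lemma prod_fact_ratio_atLeastAtMost_pred:
  "(\<Prod>k=1..m - 1. fact k / fact (2 * k + 1)) = fact_ratio_prod m"
  by (cases m) (simp_all only: prod_fact_ratio_atLeastAtMost, simp_all)

lemma prod_fact_ratio_sq:
  "(\<Prod>k\<in>A. (fact k)\<^sup>2 / (fact (2 * k + 1))\<^sup>2) = (\<Prod>k\<in>A. fact k / fact (2 * k + 1) :: real)\<^sup>2"
  by (simp only: prod_power_distrib power_divide)

lemma prod_fact_ratio_sq_from_1:
  "(\<Prod>k=1..m. (fact (k - 1))\<^sup>2 / (fact (2 * k - 1))\<^sup>2) = (fact_ratio_prod m)\<^sup>2"
proof (induction m)
  case (Suc m)
  then show ?case
    by (simp add: fact_ratio_def power_mult_distrib power_divide del: fact_Suc)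
qed simp

text \<open>The factor at \<open>k = 1\<close> is 1, so starting at 2 changes nothing.\<close>

lemma prod_fact_ratio_sq_from_2:
  "(\<Prod>k=2..m. (fact (k - 1))\<^sup>2 / (fact (2 * k - 1))\<^sup>2) = (fact_ratio_prod m)\<^sup>2"
proof (cases m)
  case (Suc l)
  then have "(\<Prod>k=1..m. (fact (k - 1))\<^sup>2 / (fact (2 * k - 1))\<^sup>2 :: real) =
      (\<Prod>k=2..m. (fact (k - 1))\<^sup>2 / (fact (2 * k - 1))\<^sup>2)"
    by (subst prod.atLeast_Suc_atMost) (simp_all add: numeral_2_eq_2)
  then show ?thesis
    by (simp only: prod_fact_ratio_sq_from_1)
qed simp

lemmas prod_fact_ratio_simps = prod_fact_ratio_sq prod_fact_ratio_atLeastAtMost_pred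
  prod_fact_ratio_sq_from_1 prod_fact_ratio_sq_from_2

lemma fps_nth_tan_fps:
  "(\<lambda>k. euler_coeff (2 * k + 1)) = fps_nth tan_fps"
  "(\<lambda>k. euler_coeff (2 * k + 3)) = fps_nth (fps_shift 1 tan_fps)"
  "(\<lambda>k. euler_coeff (2 * k + 5)) = fps_nth (fps_shift 1 (fps_shift 1 tan_fps))"
  "(\<lambda>k. euler_coeff (2 * k + 7)) = fps_nth (fps_shift 1 (fps_shift 1 (fps_shift 1 tan_fps)))"
  by (simp_all add: fun_eq_iff tan_fps_def eval_nat_numeral)

lemma fps_nth_tan_fps_compose_X2:
  "(\<lambda>k. if even k then euler_coeff (k + 1) else 0) = fps_nth (tan_fps oo fps_X\<^sup>2)"
  "(\<lambda>k. if even k then euler_coeff (k + 3) else 0) = fps_nth (fps_shift 1 tan_fps oo fps_X\<^sup>2)"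
  by (auto simp: fun_eq_iff fps_nth_compose_X2 tan_fps_def numeral_3_eq_3)

lemma fps_nth_tan_fps_odd_interleaved:
  "(\<lambda>k. if odd k then euler_coeff k else 0) = (\<lambda>k. if odd k then fps_nth tan_fps (k div 2) else 0)"
  "(\<lambda>k. if odd k then euler_coeff (k + 2) else 0) =
     (\<lambda>k. if odd k then fps_nth (fps_shift 1 tan_fps) (k div 2) else 0)"
  by (auto simp: fun_eq_iff tan_fps_def elim!: oddE)

lemma fps_nth_euler_fps:
  "euler_coeff = fps_nth euler_fps"
  "(\<lambda>k. euler_coeff (k + 1)) = fps_nth (fps_shift 1 euler_fps)"
  "(\<lambda>k. euler_coeff (k + 2)) = fps_nth (fps_shift 1 (fps_shift 1 euler_fps))"
  "(\<lambda>k. euler_coeff (k + 3)) = fps_nth (fps_shift 1 (fps_shift 1 (fps_shift 1 euler_fps)))"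
  "(\<lambda>k. euler_coeff (k + 4)) = fps_nth (fps_shift 1 (fps_shift 1 (fps_shift 1 (fps_shift 1 euler_fps))))"
  by (simp_all add: fun_eq_iff euler_fps_def eval_nat_numeral)

theorem theorem6p3:
  fixes n :: nat
  shows
    \<comment> \<open>H12\<close>
    "(let H = hankel_det (\<lambda>k. if even k then euler_coeff (k + 1) else 0) in
        H 0 = 1 \<and>
        (n \<ge> 1 \<longrightarrow>
          H n = 2 ^ ((n - 1)^2) * (fact (n - 1) / fact (2*n - 1)) *
            (\<Prod>k=1..n - 1. (fact (k - 1))^2 / (fact (2*k - 1))^2)))
   \<and> (let H = hankel_det (\<lambda>k. euler_coeff (2*k + 1)) in
        H 0 = 1 \<and>
        (n \<ge> 1 \<longrightarrow>
          H n = 2 ^ ((n - 1) * (2*n - 1)) *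
            (\<Prod>k=1..2*n - 2. fact k / fact (2*k + 1))))
   \<and> (let H = hankel_det (\<lambda>k. if odd k then euler_coeff (k + 2) else 0) in
        H (2*n + 1) = 0 \<and>
        H (2*n) = (-1) ^ n * 2 ^ (2*n * (2*n - 1)) *
          (\<Prod>k=1..2*n - 1. (fact k)^2 / (fact (2*k + 1))^2))
   \<and> (let H = hankel_det (\<lambda>k. if odd k then euler_coeff k else 0) in
        H (2*n + 1) = 0 \<and>
        H 0 = 1 \<and>
        (n \<ge> 1 \<longrightarrow>
          H (2*n) = (-1) ^ n * 2 ^ (2 * (n - 1) * (2*n - 1)) *
            (\<Prod>k=1..2*n - 2. (fact k)^2 / (fact (2*k + 1))^2)))
   \<and> (let H = hankel_det (\<lambda>k. euler_coeff (k + 1)) in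
        H 0 = 1 \<and>
        (n \<ge> 1 \<longrightarrow>
          H n = fact (n - 1) / (2 ^ (n - 1) * fact (2*n - 1)) *
            (\<Prod>k=1..n - 2. (fact k)^2 / (fact (2*k + 1))^2)))
   \<and> (let H = hankel_det euler_coeff in
        H 0 = 1 \<and>
        (n \<ge> 1 \<longrightarrow>
          H n = (-1) ^ (n * (n - 1) div 2) * (1 / 2 ^ (n - 1)) *
            (\<Prod>k=2..n - 1. (fact (k - 1))^2 / (fact (2*k - 1))^2)))
   \<and> (let H = hankel_det (\<lambda>k. euler_coeff (k + 2)) in
        H n = (-1) ^ (n * (n - 1) div 2) * (1 / 2 ^ n) *
          (\<Prod>k=2..n. (fact (k - 1))^2 / (fact (2*k - 1))^2))
   \<and> (let H = hankel_det (\<lambda>k. euler_coeff (k + 3)) in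
        H n = (real n + 1) * fact (n + 1) / (2 ^ n * fact (2*n + 1)) *
          (\<Prod>k=1..n - 1. (fact k)^2 / (fact (2*k + 1))^2))
   \<and> (let H = hankel_det (\<lambda>k. euler_coeff (k + 4)) in
        H n = (-1) ^ (n * (n - 1) div 2) *
          ((real n + 1) * (real n + 2) * ((real n)^2 + 3 * real n + 1) / 2 ^ (n + 1)) *
          (\<Prod>k=1..n. (fact k)^2 / (fact (2*k + 1))^2))
   \<and> (let H = hankel_det (\<lambda>k. if even k then euler_coeff (k + 3) else 0) in
        \<comment> \<open>the exponent is -1 for n = 0, hence the integer power\<close>
        H (2*n) = 2 powi (4 * (int n)^2 - 1) * (fact (2*n + 2) / fact (4*n + 1)) *
          (\<Prod>k=1..2*n - 1. (fact k)^2 / (fact (2*k + 1))^2) \<and>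
        H (2*n + 1) = 2 ^ (4*n * (n + 1)) * ((2 * real n + 1) * fact (2*n + 2) / fact (4*n + 3)) *
          (\<Prod>k=1..2*n. (fact k)^2 / (fact (2*k + 1))^2))
   \<and> (let H = hankel_det (\<lambda>k. euler_coeff (2*k + 3)) in
        H n = 2 ^ (n * (2*n - 1)) *
          (\<Prod>k=1..2*n - 1. fact k / fact (2*k + 1)))
   \<and> (let H = hankel_det (\<lambda>k. euler_coeff (2*k + 5)) in
        H n = 2 ^ (n * (2*n + 1)) * (real n + 1) * (2 * real n + 1) *
          (\<Prod>k=1..2*n. fact k / fact (2*k + 1)))
   \<and> (let H = hankel_det (\<lambda>k. euler_coeff (2*k + 7)) in
        H n = 2 ^ (n * (2*n + 3)) * (2 * real n + 1) * (4 * (real n)^2 + 10 * real n + 3) *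
          ((real n + 1) * (real n + 2) * (2 * real n + 3) / 3) *
          (\<Prod>k=1..2*n + 1. fact k / fact (2*k + 1)))"
  unfolding Let_def
proof (intro conjI impI, goal_cases)
  case 2
  then obtain m where n: "n = Suc m" by (cases n) auto
  have "fact m / fact (2 * Suc m - 1) = fact_ratio m"
    by (simp add: fact_ratio_def)
  then show ?case
    unfolding fps_nth_tan_fps_compose_X2 n hankel_det_tan_X2 prod_fact_ratio_simps by simp
next
  case 4
  then obtain m where n: "n = Suc m" by (cases n) auto
  have "2 * Suc m - 2 = 2 * m" "Suc m - 1 = m" "2 * Suc m - 1 = 2 * m + 1"
    by simp_all
  then show ?case
    unfolding fps_nth_tan_fps n hankel_det_tan by (simp only: prod_fact_ratio_sq prod_fact_ratio_atLeastAtMost) simp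
next
  case 5
  show ?case
    unfolding fps_nth_tan_fps_odd_interleaved
    by (rule hankel_det_odd_interleaved_sfrac(2)[OF tan_fps_sfrac_1])
next
  case 6
  show ?case
    unfolding fps_nth_tan_fps_odd_interleaved hankel_det_odd_interleaved_sfrac(1)[OF tan_fps_sfrac_1]
      hankel_det_tan_1 prod_fact_ratio_simps
    by (simp add: power_mult_distrib flip: power_mult)
next
  case 7
  show ?case
    unfolding fps_nth_tan_fps_odd_interleaved
    by (rule hankel_det_odd_interleaved_sfrac(2)[OF tan_fps_sfrac])
next
  case 9
  then obtain m where n: "n = Suc m" by (cases n) auto
  have "2 * Suc m - 2 = 2 * m" "Suc m - 1 = m" "2 * Suc m - 1 = 2 * m + 1"
    by simp_all
  then show ?case
    unfolding fps_nth_tan_fps_odd_interleaved hankel_det_odd_interleaved_sfrac(1)[OF tan_fps_sfrac]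
      n hankel_det_tan
    by (simp only: prod_fact_ratio_sq prod_fact_ratio_atLeastAtMost) (simp add: power_mult_distrib mult_ac flip: power_mult)
next
  case 11
  then obtain m where n: "n = Suc m" by (cases n) auto
  \<comment> \<open>For \<open>n = 1\<close> the upper limit truncates to 0, which correctly gives
    an empty product.\<close>
  have "Suc m - 2 = m - 1" "Suc m - 1 = m"
    "fact m / (2 ^ m * fact (2 * Suc m - 1)) = fact_ratio m / 2 ^ m"
    by (simp_all add: fact_ratio_def)
  then show ?case
    unfolding fps_nth_euler_fps(2) n hankel_det_euler_1 by (simp only: prod_fact_ratio_simps)
next
  case 13
  then obtain m where n: "n = Suc m" by (cases n) auto
  have "Suc m - 1 = m" by simp
  then show ?case
    unfolding fps_nth_euler_fps(1) n hankel_det_euler by (simp only: prod_fact_ratio_simps) simp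
next
  case 14
  show ?case
    unfolding fps_nth_euler_fps(3) hankel_det_euler_2 prod_fact_ratio_simps by simp
next
  case 15
  have "(real n + 1) * fact (n + 1) / (2 ^ n * fact (2 * n + 1)) = (real n + 1)\<^sup>2 * fact_ratio n / 2 ^ n"
    by (simp add: fact_ratio_def power2_eq_square ac_simps)
  then show ?case
    unfolding fps_nth_euler_fps(4) hankel_det_euler_3 prod_fact_ratio_simps
    by (simp only:)
next
  case 16
  show ?case
    unfolding fps_nth_euler_fps(5) hankel_det_euler_4 prod_fact_ratio_sq prod_fact_ratio_atLeastAtMost by simp
next
  case 17
  have "2 powi (4 * (int n)\<^sup>2 - 1) = (2 ^ (4 * n\<^sup>2) / 2 :: real)"
  proof -
    have "2 powi (4 * (int n)\<^sup>2 - 1) = (2 :: real) powi (int (4 * n\<^sup>2) - 1)"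
      by simp
    also have "\<dots> = 2 powi int (4 * n\<^sup>2) / 2 powi 1"
      by (rule power_int_diff) simp
    finally show ?thesis
      by (simp only: power_int_of_nat power_int_1_right)
  qed
  moreover have "fact (2 * n + 2) / fact (4 * n + 1) = (2 * real n + 2) * (2 * real n + 1) * fact_ratio (2 * n)"
    by (simp add: fact_ratio_def algebra_simps)
  ultimately show ?case
    unfolding fps_nth_tan_fps_compose_X2 hankel_det_tan_1_X2 prod_fact_ratio_simps by simp
next
  case 18
  have "(2 * real n + 1) * fact (2 * n + 2) / fact (4 * n + 3) =
      (2 * real n + 1) * (2 * real n + 2) * fact_ratio (2 * n + 1)"
    by (simp add: fact_ratio_def numeral_3_eq_3 ac_simps)
  then show ?case
    unfolding fps_nth_tan_fps_compose_X2 hankel_det_tan_1_X2 prod_fact_ratio_sq prod_fact_ratio_atLeastAtMost by simp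
next
  case 19
  show ?case
    unfolding fps_nth_tan_fps hankel_det_tan_1 prod_fact_ratio_simps by simp
next
  case 20
  show ?case
    unfolding fps_nth_tan_fps hankel_det_tan_2 prod_fact_ratio_sq prod_fact_ratio_atLeastAtMost by simp
next
  case 21
  show ?case
    unfolding fps_nth_tan_fps hankel_det_tan_3 prod_fact_ratio_sq prod_fact_ratio_atLeastAtMost by simp
\<comment> \<open>Only the goals about size 0 remain.\<close>
qed (rule hankel_det_0)+

end
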